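(* Let $k$ be a field, let $A$ be an associative unital $k$-algebra and let $I$ be a left and right $A$-module. Let $C\in \operatorname{Hom}_k(A\otimes_k A, I)$ satisfy the cocycle condition $$xC(y,z)-C(xy,z)+C(x,yz)-C(x,y)z=0\quad\text{for all } x,y,z\in A .$$ Then the exact sequence $$0\rightarrow I\rightarrow I\oplus^C A\rightarrow A\rightarrow 0$$ is a square zero extension of $A$ with the module $I$. Moreover, any square zero extension of $A$ with $I$ arises this way for some $C\in \operatorname{Hom}_k(A\otimes_k A,I)$ satisfying the cocycle condition.
   Context: A left and right $A$-module $I$ means an $A$-$A$-bimodule on which $k$ acts centrally. For $C\in \operatorname{Hom}_k(A\otimes_k A,I)$ write $C(x,y)=C(x\otimes y)$, and let $I\oplus^C A$ denote the abelian group (and $k$-vector space) $I\oplus A$ with the product $(u,x)(v,y)=(uy+xv+C(x,y),\,xy)$. The maps in the sequence are $u\mapsto (u,0)$ and $(u,x)\mapsto x$. A square zero extension of $A$ with $I$ is an exact sequence $0\to I\xrightarrow{i} B\xrightarrow{p} A\to 0$ where $B$ is an associative unital $k$-algebra, $p$ is a homomorphism of unital $k$-algebras, $i(I)$ is a two-sided ideal with $i(I)^2=0$, and the left and right $A$-module structure on $I$ is the one induced from $B$: $xu=s(x)u$, $ux=us(x)$ for any $k$-linear section $s$ of $p$ (with $I$ identified with $i(I)$). "Arises this way" means that there is an isomorphism of unital $k$-algebras $B\cong I\oplus^C A$ which is compatible with the inclusions of $I$ and the projections to $A$. *)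

theory Defs
  imports "HOL-Algebra.Module" "HOL-Algebra.QuotRing" "HOL-Algebra.Ideal_Product"
begin

text \<open>
  The ground ring is a record \<open>K\<close>; the main theorem assumes that it is a field. Vector spaces over \<open>K\<close>
  are HOL-Algebra modules, whose record type also contains the (then meaningless) ring
  components \<open>mult\<close> and \<open>one\<close>.
\<close>

section \<open>Algebras, bimodules, linear maps\<close>

text \<open>The locale \<open>algebra\<close> of HOL-Algebra is restricted to commutative algebras.\<close>

locale unital_algebra = module K A + ring A
  for K :: "('k, 'm) ring_scheme" and A :: "('k, 'a, 'n) module_scheme" +
  assumes smult_mult_left:
    "\<lbrakk> c \<in> carrier K; x \<in> carrier A; y \<in> carrier A \<rbrakk> \<Longrightarrow>
      (c \<odot>\<^bsub>A\<^esub> x) \<otimes>\<^bsub>A\<^esub> y = c \<odot>\<^bsub>A\<^esub> (x \<otimes>\<^bsub>A\<^esub> y)"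
    and smult_mult_right:
    "\<lbrakk> c \<in> carrier K; x \<in> carrier A; y \<in> carrier A \<rbrakk> \<Longrightarrow>
      x \<otimes>\<^bsub>A\<^esub> (c \<odot>\<^bsub>A\<^esub> y) = c \<odot>\<^bsub>A\<^esub> (x \<otimes>\<^bsub>A\<^esub> y)"

record ('k, 'a, 'i) bimodule = "('k, 'i) module" +
  lact :: "'a \<Rightarrow> 'i \<Rightarrow> 'i"
  ract :: "'i \<Rightarrow> 'a \<Rightarrow> 'i"

text \<open>
  In the next locale, \<open>lact_central\<close> and \<open>ract_central\<close> say that \<open>K\<close> acts centrally: both actions of
  \<open>A\<close> restrict along \<open>K \<rightarrow> A\<close> to the given scalar multiplication of \<open>I\<close>.
\<close>

locale central_bimodule = A: unital_algebra K A + I: module K I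
  for K :: "('k, 'm) ring_scheme" and A :: "('k, 'a, 'n) module_scheme"
    and I :: "('k, 'a, 'i, 'l) bimodule_scheme" +
  assumes lact_closed: "\<lbrakk> x \<in> carrier A; u \<in> carrier I \<rbrakk> \<Longrightarrow> lact I x u \<in> carrier I"
    and lact_add_left: "\<lbrakk> x \<in> carrier A; y \<in> carrier A; u \<in> carrier I \<rbrakk> \<Longrightarrow>
      lact I (x \<oplus>\<^bsub>A\<^esub> y) u = lact I x u \<oplus>\<^bsub>I\<^esub> lact I y u"
    and lact_add_right: "\<lbrakk> x \<in> carrier A; u \<in> carrier I; v \<in> carrier I \<rbrakk> \<Longrightarrow>
      lact I x (u \<oplus>\<^bsub>I\<^esub> v) = lact I x u \<oplus>\<^bsub>I\<^esub> lact I x v"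
    and lact_mult: "\<lbrakk> x \<in> carrier A; y \<in> carrier A; u \<in> carrier I \<rbrakk> \<Longrightarrow>
      lact I (x \<otimes>\<^bsub>A\<^esub> y) u = lact I x (lact I y u)"
    and lact_one: "u \<in> carrier I \<Longrightarrow> lact I \<one>\<^bsub>A\<^esub> u = u"
    and ract_closed: "\<lbrakk> u \<in> carrier I; x \<in> carrier A \<rbrakk> \<Longrightarrow> ract I u x \<in> carrier I"
    and ract_add_left: "\<lbrakk> u \<in> carrier I; v \<in> carrier I; x \<in> carrier A \<rbrakk> \<Longrightarrow>
      ract I (u \<oplus>\<^bsub>I\<^esub> v) x = ract I u x \<oplus>\<^bsub>I\<^esub> ract I v x"
    and ract_add_right: "\<lbrakk> u \<in> carrier I; x \<in> carrier A; y \<in> carrier A \<rbrakk> \<Longrightarrow>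
      ract I u (x \<oplus>\<^bsub>A\<^esub> y) = ract I u x \<oplus>\<^bsub>I\<^esub> ract I u y"
    and ract_mult: "\<lbrakk> u \<in> carrier I; x \<in> carrier A; y \<in> carrier A \<rbrakk> \<Longrightarrow>
      ract I u (x \<otimes>\<^bsub>A\<^esub> y) = ract I (ract I u x) y"
    and ract_one: "u \<in> carrier I \<Longrightarrow> ract I u \<one>\<^bsub>A\<^esub> = u"
    and lact_ract: "\<lbrakk> x \<in> carrier A; u \<in> carrier I; y \<in> carrier A \<rbrakk> \<Longrightarrow>
      ract I (lact I x u) y = lact I x (ract I u y)"
    and lact_central: "\<lbrakk> c \<in> carrier K; u \<in> carrier I \<rbrakk> \<Longrightarrow>
      lact I (c \<odot>\<^bsub>A\<^esub> \<one>\<^bsub>A\<^esub>) u = c \<odot>\<^bsub>I\<^esub> u"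
    and ract_central: "\<lbrakk> c \<in> carrier K; u \<in> carrier I \<rbrakk> \<Longrightarrow>
      ract I u (c \<odot>\<^bsub>A\<^esub> \<one>\<^bsub>A\<^esub>) = c \<odot>\<^bsub>I\<^esub> u"

definition lin_hom ::
  "('k, 'm) ring_scheme \<Rightarrow> ('k, 'a, 'n) module_scheme \<Rightarrow> ('k, 'b, 'l) module_scheme \<Rightarrow> ('a \<Rightarrow> 'b) set"
  where "lin_hom K M N =
    {f \<in> carrier M \<rightarrow> carrier N.
      (\<forall>x\<in>carrier M. \<forall>y\<in>carrier M. f (x \<oplus>\<^bsub>M\<^esub> y) = f x \<oplus>\<^bsub>N\<^esub> f y) \<and>
      (\<forall>c\<in>carrier K. \<forall>x\<in>carrier M. f (c \<odot>\<^bsub>M\<^esub> x) = c \<odot>\<^bsub>N\<^esub> f x)}"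

text \<open>Library ring homomorphisms and isomorphisms preserve the unit.\<close>

definition alg_hom ::
  "('k, 'm) ring_scheme \<Rightarrow> ('k, 'a, 'n) module_scheme \<Rightarrow> ('k, 'b, 'l) module_scheme \<Rightarrow> ('a \<Rightarrow> 'b) set"
  where "alg_hom K A B = ring_hom A B \<inter> lin_hom K A B"

definition alg_iso ::
  "('k, 'm) ring_scheme \<Rightarrow> ('k, 'a, 'n) module_scheme \<Rightarrow> ('k, 'b, 'l) module_scheme \<Rightarrow> ('a \<Rightarrow> 'b) set"
  where "alg_iso K A B = ring_iso A B \<inter> lin_hom K A B"

section \<open>The tensor product over \<open>K\<close>\<close>

text \<open>
  \<open>M \<otimes> N\<close> is the quotient of the free module on \<open>M \<times> N\<close> by the submodule generated by the
  bilinearity relations. The components \<open>mult\<close> and \<open>one\<close> of the module records are irrelevant.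
\<close>

definition free_module :: "('k, 'm) ring_scheme \<Rightarrow> 's set \<Rightarrow> ('k, 's \<Rightarrow> 'k) module"
  where "free_module K S =
    \<lparr> carrier = {f. (\<forall>s. f s \<in> carrier K) \<and> (\<forall>s. s \<notin> S \<longrightarrow> f s = \<zero>\<^bsub>K\<^esub>) \<and> finite {s. f s \<noteq> \<zero>\<^bsub>K\<^esub>}},
      mult = undefined, one = undefined,
      zero = (\<lambda>s. \<zero>\<^bsub>K\<^esub>),
      add = (\<lambda>f g s. f s \<oplus>\<^bsub>K\<^esub> g s),
      smult = (\<lambda>c f s. c \<otimes>\<^bsub>K\<^esub> f s) \<rparr>"

definition free_gen :: "('k, 'm) ring_scheme \<Rightarrow> 's \<Rightarrow> 's \<Rightarrow> 'k"
  where "free_gen K s = (\<lambda>t. if t = s then \<one>\<^bsub>K\<^esub> else \<zero>\<^bsub>K\<^esub>)"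

definition submodule_span ::
  "('k, 'm) ring_scheme \<Rightarrow> ('k, 'a, 'n) module_scheme \<Rightarrow> 'a set \<Rightarrow> 'a set"
  where "submodule_span K M X = \<Inter> {H. submodule H K M \<and> X \<subseteq> H}"

definition quotient_module :: "('k, 'a, 'n) module_scheme \<Rightarrow> 'a set \<Rightarrow> ('k, 'a set) module"
  where "quotient_module M H =
    \<lparr> carrier = a_rcosets\<^bsub>M\<^esub> H,
      mult = undefined, one = undefined,
      zero = H,
      add = (\<lambda>X Y. X <+>\<^bsub>M\<^esub> Y),
      smult = (\<lambda>c X. H <+>\<^bsub>M\<^esub> ((\<lambda>x. c \<odot>\<^bsub>M\<^esub> x) ` X)) \<rparr>"

definition tensor_relations ::
  "('k, 'm) ring_scheme \<Rightarrow> ('k, 'a, 'n) module_scheme \<Rightarrow> ('k, 'b, 'l) module_scheme \<Rightarrow> ('a \<times> 'b \<Rightarrow> 'k) set"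
  where "tensor_relations K M N =
    (let F = free_module K (carrier M \<times> carrier N); \<delta> = free_gen K in
      {\<delta> (x \<oplus>\<^bsub>M\<^esub> x', y) \<ominus>\<^bsub>F\<^esub> (\<delta> (x, y) \<oplus>\<^bsub>F\<^esub> \<delta> (x', y)) | x x' y.
         x \<in> carrier M \<and> x' \<in> carrier M \<and> y \<in> carrier N} \<union>
      {\<delta> (x, y \<oplus>\<^bsub>N\<^esub> y') \<ominus>\<^bsub>F\<^esub> (\<delta> (x, y) \<oplus>\<^bsub>F\<^esub> \<delta> (x, y')) | x y y'.
         x \<in> carrier M \<and> y \<in> carrier N \<and> y' \<in> carrier N} \<union>
      {\<delta> (c \<odot>\<^bsub>M\<^esub> x, y) \<ominus>\<^bsub>F\<^esub> c \<odot>\<^bsub>F\<^esub> \<delta> (x, y) | c x y.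
         c \<in> carrier K \<and> x \<in> carrier M \<and> y \<in> carrier N} \<union>
      {\<delta> (x, c \<odot>\<^bsub>N\<^esub> y) \<ominus>\<^bsub>F\<^esub> c \<odot>\<^bsub>F\<^esub> \<delta> (x, y) | c x y.
         c \<in> carrier K \<and> x \<in> carrier M \<and> y \<in> carrier N})"

definition tensor_submodule ::
  "('k, 'm) ring_scheme \<Rightarrow> ('k, 'a, 'n) module_scheme \<Rightarrow> ('k, 'b, 'l) module_scheme \<Rightarrow> ('a \<times> 'b \<Rightarrow> 'k) set"
  where "tensor_submodule K M N =
    submodule_span K (free_module K (carrier M \<times> carrier N)) (tensor_relations K M N)"

definition tensor_product ::
  "('k, 'm) ring_scheme \<Rightarrow> ('k, 'a, 'n) module_scheme \<Rightarrow> ('k, 'b, 'l) module_scheme \<Rightarrow>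
    ('k, ('a \<times> 'b \<Rightarrow> 'k) set) module"
  where "tensor_product K M N =
    quotient_module (free_module K (carrier M \<times> carrier N)) (tensor_submodule K M N)"

definition pure_tensor ::
  "('k, 'm) ring_scheme \<Rightarrow> ('k, 'a, 'n) module_scheme \<Rightarrow> ('k, 'b, 'l) module_scheme \<Rightarrow>
    'a \<Rightarrow> 'b \<Rightarrow> ('a \<times> 'b \<Rightarrow> 'k) set"
  where "pure_tensor K M N x y =
    tensor_submodule K M N +>\<^bsub>free_module K (carrier M \<times> carrier N)\<^esub> free_gen K (x, y)"

section \<open>Cocycles and square zero extensions\<close>

text \<open>For a linear map \<open>C\<close> on \<open>A \<otimes> A\<close>, this is \<open>C(x, y) = C(x \<otimes> y)\<close>.\<close>

definition on_pure ::
  "('k, 'm) ring_scheme \<Rightarrow> ('k, 'a, 'n) module_scheme \<Rightarrow> (('a \<times> 'a \<Rightarrow> 'k) set \<Rightarrow> 'i) \<Rightarrow> 'a \<Rightarrow> 'a \<Rightarrow> 'i"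
  where "on_pure K A C x y = C (pure_tensor K A A x y)"

definition cocycle ::
  "('k, 'm) ring_scheme \<Rightarrow> ('k, 'a, 'n) module_scheme \<Rightarrow> ('k, 'a, 'i, 'l) bimodule_scheme \<Rightarrow>
    (('a \<times> 'a \<Rightarrow> 'k) set \<Rightarrow> 'i) \<Rightarrow> bool"
  where "cocycle K A I C \<longleftrightarrow>
    (\<forall>x\<in>carrier A. \<forall>y\<in>carrier A. \<forall>z\<in>carrier A.
      lact I x (on_pure K A C y z) \<ominus>\<^bsub>I\<^esub> on_pure K A C (x \<otimes>\<^bsub>A\<^esub> y) z
        \<oplus>\<^bsub>I\<^esub> on_pure K A C x (y \<otimes>\<^bsub>A\<^esub> z) \<ominus>\<^bsub>I\<^esub> ract I (on_pure K A C x y) z = \<zero>\<^bsub>I\<^esub>)"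

text \<open>
  The algebra \<open>I \<oplus>\<^sup>C A\<close>. Records carry the unit as data; if \<open>C\<close> is a cocycle then \<open>(-C(1,1), 1)\<close> is the
  unique two-sided unit of the twisted product (in general \<open>(0, 1)\<close> is not a unit, since \<open>C\<close> is not
  assumed to be normalised).
\<close>

definition twisted_sum ::
  "('k, 'm) ring_scheme \<Rightarrow> ('k, 'a, 'n) module_scheme \<Rightarrow> ('k, 'a, 'i, 'l) bimodule_scheme \<Rightarrow>
    (('a \<times> 'a \<Rightarrow> 'k) set \<Rightarrow> 'i) \<Rightarrow> ('k, 'i \<times> 'a) module"
  where "twisted_sum K A I C =
    \<lparr> carrier = carrier I \<times> carrier A,
      mult = (\<lambda>(u, x) (v, y).
        (ract I u y \<oplus>\<^bsub>I\<^esub> lact I x v \<oplus>\<^bsub>I\<^esub> on_pure K A C x y, x \<otimes>\<^bsub>A\<^esub> y)),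
      one = (\<ominus>\<^bsub>I\<^esub> on_pure K A C \<one>\<^bsub>A\<^esub> \<one>\<^bsub>A\<^esub>, \<one>\<^bsub>A\<^esub>),
      zero = (\<zero>\<^bsub>I\<^esub>, \<zero>\<^bsub>A\<^esub>),
      add = (\<lambda>(u, x) (v, y). (u \<oplus>\<^bsub>I\<^esub> v, x \<oplus>\<^bsub>A\<^esub> y)),
      smult = (\<lambda>c (u, x). (c \<odot>\<^bsub>I\<^esub> u, c \<odot>\<^bsub>A\<^esub> x)) \<rparr>"

text \<open>
  Exactness of \<open>0 \<rightarrow> I \<rightarrow> B \<rightarrow> A \<rightarrow> 0\<close> is \<open>i_inj\<close>, \<open>exact_middle\<close> and \<open>p_surj\<close>. Over a field a linear
  section of \<open>p\<close> always exists, so the universally quantified condition \<open>induced_action\<close> is not vacuous.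
\<close>

locale square_zero_extension =
  I: central_bimodule K A I + B: unital_algebra K B
  for K :: "('k, 'm) ring_scheme" and A :: "('k, 'a, 'n) module_scheme"
    and I :: "('k, 'a, 'i, 'l) bimodule_scheme" and B :: "('k, 'b, 'q) module_scheme"
    and i :: "'i \<Rightarrow> 'b" and p :: "'b \<Rightarrow> 'a" +
  assumes i_hom: "i \<in> lin_hom K I B"
    and p_hom: "p \<in> alg_hom K B A"
    and i_inj: "inj_on i (carrier I)"
    and exact_middle: "i ` carrier I = a_kernel B A p"
    and p_surj: "p ` carrier B = carrier A"
    and ideal_image: "ideal (i ` carrier I) B"
    and square_zero: "ideal_prod B (i ` carrier I) (i ` carrier I) = {\<zero>\<^bsub>B\<^esub>}"
    and induced_action:
      "\<And>s x u. \<lbrakk> s \<in> lin_hom K A B; \<And>y. y \<in> carrier A \<Longrightarrow> p (s y) = y; x \<in> carrier A; u \<in> carrier I \<rbrakk>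
        \<Longrightarrow> i (lact I x u) = s x \<otimes>\<^bsub>B\<^esub> i u \<and> i (ract I u x) = i u \<otimes>\<^bsub>B\<^esub> s x"

text \<open>The extension \<open>(B, i, p)\<close> is isomorphic to \<open>I \<oplus>\<^sup>C A\<close>, compatibly with the maps from \<open>I\<close> and to \<open>A\<close>.\<close>

definition arises_from ::
  "('k, 'm) ring_scheme \<Rightarrow> ('k, 'a, 'n) module_scheme \<Rightarrow> ('k, 'a, 'i, 'l) bimodule_scheme \<Rightarrow>
    ('k, 'b, 'q) module_scheme \<Rightarrow> ('i \<Rightarrow> 'b) \<Rightarrow> ('b \<Rightarrow> 'a) \<Rightarrow> (('a \<times> 'a \<Rightarrow> 'k) set \<Rightarrow> 'i) \<Rightarrow> bool"
  where "arises_from K A I B i p C \<longleftrightarrow>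
    (\<exists>\<phi> \<in> alg_iso K B (twisted_sum K A I C).
      (\<forall>u\<in>carrier I. \<phi> (i u) = (u, \<zero>\<^bsub>A\<^esub>)) \<and> (\<forall>b\<in>carrier B. snd (\<phi> b) = p b))"

end

theory Submission
  imports Defs
begin

text \<open>
  The cocycle condition on \<open>C\<close> is exactly associativity of the twisted product, and its instances at
  \<open>(1, 1, x)\<close> and \<open>(x, 1, 1)\<close> make \<open>(-C(1, 1), 1)\<close> a unit. Conversely, over a field the projection
  \<open>p : B \<rightarrow> A\<close> has a linear section \<open>s\<close>: by Zorn's lemma the kernel of \<open>p\<close> has a complement. The defect
  \<open>C(x, y) = s(x) s(y) - s(x y)\<close> of multiplicativity lies in \<open>I\<close> and is bilinear, hence a linear map on
  \<open>A \<otimes> A\<close> by the universal property. Comparing the two bracketings of \<open>s(x) s(y) s(z)\<close> shows that it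
  is a cocycle, and \<open>(u, x) \<mapsto> u + s(x)\<close> is an isomorphism from the twisted sum to \<open>B\<close>.
\<close>

section \<open>Modules\<close>

text \<open>A linear section gives every element of \<open>B\<close> a unique form
  \<open>i u + s x\<close>. Expanding \<open>(i u + s x) (i v + s y)\<close> with
  \<open>i u i v = 0\<close> leaves exactly the twisted product, which is where its formula comes
  from. The section need not preserve the unit, so \<open>C\<close> is not normalised: here
  \<open>C(1, 1)\<close> measures how far \<open>s 1\<close> is from the unit of \<open>B\<close>,
  by \<open>1 = s 1 - i (C(1, 1))\<close>, and this is the origin of the unit
  \<open>(-C(1, 1), 1)\<close>.

  The field enters through the existence of complements, where a nonzero scalar has to be inverted.

  A linear map on the tensor product is a function on cosets in a free module and is awkward to
  compute with. Calculations therefore run on the two-variable function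
  \<open>on_pure K A C\<close>: a given \<open>C\<close> yields a bilinear function, and the
  bilinear defect of a section yields a \<open>C\<close>. Identities in \<open>I\<close> about that
  defect are checked in \<open>B\<close>, after applying the injective map \<open>i\<close>, because
  there both actions are multiplications by values of \<open>s\<close>.\<close>

lemma lin_homD:
  assumes "f \<in> lin_hom K M N"
  shows "x \<in> carrier M \<Longrightarrow> f x \<in> carrier N"
    and "x \<in> carrier M \<Longrightarrow> y \<in> carrier M \<Longrightarrow> f (x \<oplus>\<^bsub>M\<^esub> y) = f x \<oplus>\<^bsub>N\<^esub> f y"
    and "c \<in> carrier K \<Longrightarrow> x \<in> carrier M \<Longrightarrow> f (c \<odot>\<^bsub>M\<^esub> x) = c \<odot>\<^bsub>N\<^esub> f x"
  using assms by (auto simp: lin_hom_def)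

lemma lin_hom_abelian_group_hom:
  assumes "module K M" "module K N" "f \<in> lin_hom K M N"
  shows "abelian_group_hom M N f"
proof -
  interpret M: module K M by fact
  interpret N: module K N by fact
  show ?thesis
    by (intro abelian_group_homI M.abelian_group_axioms N.abelian_group_axioms
        group_hom.intro M.a_group N.a_group group_hom_axioms.intro homI)
      (simp_all add: lin_homD[OF assms(3)])
qed

section \<open>Submodules, spans and quotient modules\<close>

context module
begin

lemma submodule_submodule_span:
  assumes "X \<subseteq> carrier M"
  shows "submodule (submodule_span R M X) R M"
proof (rule submoduleI)
  \<comment> \<open>The carrier itself belongs to the intersected family, so the intersection is not
    over the empty family.\<close>
  show "submodule_span R M X \<subseteq> carrier M"
    using carrier_is_submodule assms by (auto simp: submodule_span_def)
qed (auto simp: submodule_span_def submoduleE subgroup.one_closed[OF submodule.axioms(1), simplified])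

lemma submodule_span_superset: "X \<subseteq> submodule_span R M X"
  by (auto simp: submodule_span_def)

lemma submodule_span_least: "submodule H R M \<Longrightarrow> X \<subseteq> H \<Longrightarrow> submodule_span R M X \<subseteq> H"
  by (auto simp: submodule_span_def)

text \<open>Kernels appear in three roles: they absorb the span of the tensor relations, they are
  what receives a complement when a section is built, and one of them is the ideal \<open>I\<close>
  of the twisted sum.\<close>

lemma submodule_lin_hom_kernel:
  assumes "module R N" "f \<in> lin_hom R M N"
  shows "submodule {x \<in> carrier M. f x = \<zero>\<^bsub>N\<^esub>} R M"
proof -
  interpret N: module R N by fact
  interpret f: abelian_group_hom M N f
    using lin_hom_abelian_group_hom[OF module_axioms assms] .
  show ?thesis
    by (rule submoduleI) (auto simp: lin_homD[OF assms(2)])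
qed

lemma abelian_subgroup_submodule:
  assumes "submodule H R M"
  shows "abelian_subgroup H M"
  using assms by (simp add: abelian_group_axioms abelian_subgroupI3 additive_subgroupI submodule_def)

context
  fixes H
  assumes H: "submodule H R M"
begin

interpretation H: abelian_subgroup H M
  using abelian_subgroup_submodule[OF H] .

text \<open>The tensor relations are differences; in this form each of them becomes an equation
  between cosets.\<close>

lemma coset_eqI:
  assumes "x \<in> carrier M" "y \<in> carrier M" "x \<ominus>\<^bsub>M\<^esub> y \<in> H"
  shows "H +>\<^bsub>M\<^esub> x = H +>\<^bsub>M\<^esub> y"
proof (rule a_coset_add_inv1)
  show "H +>\<^bsub>M\<^esub> (x \<oplus>\<^bsub>M\<^esub> \<ominus>\<^bsub>M\<^esub> y) = H"
    using assms H.a_subgroup by (intro a_coset_join2) (auto simp: a_minus_def)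
qed (use assms H.a_subset in auto)

lemma quotient_module_add:
  assumes "x \<in> carrier M" "y \<in> carrier M"
  shows "(H +>\<^bsub>M\<^esub> x) \<oplus>\<^bsub>quotient_module M H\<^esub> (H +>\<^bsub>M\<^esub> y) = H +>\<^bsub>M\<^esub> (x \<oplus>\<^bsub>M\<^esub> y)"
  using H.a_rcos_sum[OF assms] by (simp add: quotient_module_def)

text \<open>For \<open>c = 0\<close> the scaled coset is a single point and not a coset, which is
  why the scalar multiplication of the quotient adds \<open>H\<close>. An element
  \<open>h + c (h' + x)\<close> equals \<open>(h + c h') + c x\<close>, and the bracket is again in
  \<open>H\<close>.\<close>

lemma quotient_module_smult:
  assumes "c \<in> carrier R" "x \<in> carrier M"
  shows "c \<odot>\<^bsub>quotient_module M H\<^esub> (H +>\<^bsub>M\<^esub> x) = H +>\<^bsub>M\<^esub> (c \<odot>\<^bsub>M\<^esub> x)"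
proof -
  have step: "h \<oplus>\<^bsub>M\<^esub> c \<odot>\<^bsub>M\<^esub> (h' \<oplus>\<^bsub>M\<^esub> x) = (h \<oplus>\<^bsub>M\<^esub> c \<odot>\<^bsub>M\<^esub> h') \<oplus>\<^bsub>M\<^esub> c \<odot>\<^bsub>M\<^esub> x" if "h \<in> H" "h' \<in> H" for h h'
    using that assms H.a_Hcarr by (simp add: smult_r_distr a_assoc)
  have closed: "h \<oplus>\<^bsub>M\<^esub> c \<odot>\<^bsub>M\<^esub> h' \<in> H" if "h \<in> H" "h' \<in> H" for h h'
    using that assms submoduleE[OF H] by simp
  have "c \<odot>\<^bsub>quotient_module M H\<^esub> (H +>\<^bsub>M\<^esub> x)
      = {h \<oplus>\<^bsub>M\<^esub> c \<odot>\<^bsub>M\<^esub> (h' \<oplus>\<^bsub>M\<^esub> x) | h h'. h \<in> H \<and> h' \<in> H}"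
    by (auto simp: quotient_module_def set_add_def' a_r_coset_def')
  also have "\<dots> = {h \<oplus>\<^bsub>M\<^esub> c \<odot>\<^bsub>M\<^esub> x | h. h \<in> H}"
  proof (intro equalityI subsetI)
    fix z assume "z \<in> {h \<oplus>\<^bsub>M\<^esub> c \<odot>\<^bsub>M\<^esub> (h' \<oplus>\<^bsub>M\<^esub> x) | h h'. h \<in> H \<and> h' \<in> H}"
    with step closed show "z \<in> {h \<oplus>\<^bsub>M\<^esub> c \<odot>\<^bsub>M\<^esub> x | h. h \<in> H}" by blast
  next
    fix z assume "z \<in> {h \<oplus>\<^bsub>M\<^esub> c \<odot>\<^bsub>M\<^esub> x | h. h \<in> H}"
    then obtain h where h: "h \<in> H" "z = h \<oplus>\<^bsub>M\<^esub> c \<odot>\<^bsub>M\<^esub> x" by blast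
    then have "z = h \<oplus>\<^bsub>M\<^esub> c \<odot>\<^bsub>M\<^esub> (\<zero>\<^bsub>M\<^esub> \<oplus>\<^bsub>M\<^esub> x)"
      using assms by simp
    with h H.zero_closed show "z \<in> {h \<oplus>\<^bsub>M\<^esub> c \<odot>\<^bsub>M\<^esub> (h' \<oplus>\<^bsub>M\<^esub> x) | h h'. h \<in> H \<and> h' \<in> H}"
      by blast
  qed
  also have "\<dots> = H +>\<^bsub>M\<^esub> (c \<odot>\<^bsub>M\<^esub> x)"
    by (auto simp: a_r_coset_def')
  finally show ?thesis .
qed

text \<open>Since \<open>f\<close> is constant on every coset, the image of a coset is a singleton,
  and \<open>the_elem\<close> reads off the value without choosing a representative.\<close>

lemma quotient_module_lift:
  assumes N: "module R N" and f: "f \<in> lin_hom R M N" and vanish: "\<And>h. h \<in> H \<Longrightarrow> f h = \<zero>\<^bsub>N\<^esub>"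
  obtains g where "g \<in> lin_hom R (quotient_module M H) N"
    and "\<And>x. x \<in> carrier M \<Longrightarrow> g (H +>\<^bsub>M\<^esub> x) = f x"
proof -
  interpret N: module R N by fact
  have "f ` (H +>\<^bsub>M\<^esub> x) = {f x}" if "x \<in> carrier M" for x
  proof -
    have "f y = f x" if "y \<in> H +>\<^bsub>M\<^esub> x" for y
    proof -
      obtain h where h: "h \<in> H" "y = h \<oplus>\<^bsub>M\<^esub> x"
        using \<open>y \<in> H +>\<^bsub>M\<^esub> x\<close> by (auto simp: a_r_coset_def')
      have "f y = f h \<oplus>\<^bsub>N\<^esub> f x"
        unfolding h(2) using H.a_Hcarr[OF h(1)] \<open>x \<in> carrier M\<close> by (rule lin_homD(2)[OF f])
      then show ?thesis
        using lin_homD(1)[OF f] \<open>x \<in> carrier M\<close> by (simp add: vanish[OF h(1)])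
    qed
    then have "f ` (H +>\<^bsub>M\<^esub> x) = (\<lambda>_. f x) ` (H +>\<^bsub>M\<^esub> x)"
      by (rule image_cong[OF refl])
    then show ?thesis
      using image_constant[OF H.a_rcos_self[OF that], of "f x"] by (rule trans)
  qed
  then have *: "the_elem (f ` (H +>\<^bsub>M\<^esub> x)) = f x" if "x \<in> carrier M" for x
    using that by simp
  have carrier: "\<exists>x\<in>carrier M. X = H +>\<^bsub>M\<^esub> x" if "X \<in> carrier (quotient_module M H)" for X
    using that by (auto simp: quotient_module_def A_RCOSETS_def')
  have "(\<lambda>X. the_elem (f ` X)) \<in> lin_hom R (quotient_module M H) N"
    unfolding lin_hom_def
  proof (intro CollectI conjI ballI Pi_I)
    fix X assume "X \<in> carrier (quotient_module M H)"
    then obtain x where x: "x \<in> carrier M" "X = H +>\<^bsub>M\<^esub> x" using carrier by blast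
    then show "the_elem (f ` X) \<in> carrier N"
      by (simp add: * lin_homD[OF f])
    show "the_elem (f ` (c \<odot>\<^bsub>quotient_module M H\<^esub> X)) = c \<odot>\<^bsub>N\<^esub> the_elem (f ` X)"
      if "c \<in> carrier R" for c
      using that x by (simp add: quotient_module_smult * lin_homD[OF f])
    fix Y assume "Y \<in> carrier (quotient_module M H)"
    then obtain y where "y \<in> carrier M" "Y = H +>\<^bsub>M\<^esub> y" using carrier by blast
    with x show "the_elem (f ` (X \<oplus>\<^bsub>quotient_module M H\<^esub> Y)) = the_elem (f ` X) \<oplus>\<^bsub>N\<^esub> the_elem (f ` Y)"
      by (simp add: quotient_module_add * lin_homD[OF f])
  qed
  from this * show ?thesis by (rule that)
qed

end

end

section \<open>The universal property of the tensor product\<close>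

lemma free_module_simps:
  "f \<in> carrier (free_module K S) \<longleftrightarrow> (\<forall>s. f s \<in> carrier K) \<and> (\<forall>s. s \<notin> S \<longrightarrow> f s = \<zero>\<^bsub>K\<^esub>) \<and> finite {s. f s \<noteq> \<zero>\<^bsub>K\<^esub>}"
  "f \<oplus>\<^bsub>free_module K S\<^esub> g = (\<lambda>s. f s \<oplus>\<^bsub>K\<^esub> g s)"
  "c \<odot>\<^bsub>free_module K S\<^esub> f = (\<lambda>s. c \<otimes>\<^bsub>K\<^esub> f s)"
  "\<zero>\<^bsub>free_module K S\<^esub> = (\<lambda>s. \<zero>\<^bsub>K\<^esub>)"
  by (auto simp: free_module_def)

context cring
begin

lemma module_free_module: "module R (free_module R S)"
proof (rule moduleI)
  show "abelian_group (free_module R S)"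
  proof (rule abelian_groupI)
    fix f g assume "f \<in> carrier (free_module R S)" "g \<in> carrier (free_module R S)"
    moreover have "{s. f s \<oplus> g s \<noteq> \<zero>} \<subseteq> {s. f s \<noteq> \<zero>} \<union> {s. g s \<noteq> \<zero>}" by auto
    ultimately show "f \<oplus>\<^bsub>free_module R S\<^esub> g \<in> carrier (free_module R S)"
      by (auto simp: free_module_simps intro: finite_subset)
  next
    fix f assume f: "f \<in> carrier (free_module R S)"
    have "{s. \<ominus> f s \<noteq> \<zero>} \<subseteq> {s. f s \<noteq> \<zero>}" by auto
    with f have "(\<lambda>s. \<ominus> f s) \<in> carrier (free_module R S)"
      by (auto simp: free_module_simps intro: finite_subset)
    moreover have "(\<lambda>s. \<ominus> f s) \<oplus>\<^bsub>free_module R S\<^esub> f = \<zero>\<^bsub>free_module R S\<^esub>"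
      using f by (simp add: free_module_simps l_neg)
    ultimately show "\<exists>g\<in>carrier (free_module R S). g \<oplus>\<^bsub>free_module R S\<^esub> f = \<zero>\<^bsub>free_module R S\<^esub>"
      by blast
  qed (auto simp: free_module_simps a_ac)
next
  fix c f assume cf: "c \<in> carrier R" "f \<in> carrier (free_module R S)"
  then have "{s. c \<otimes> f s \<noteq> \<zero>} \<subseteq> {s. f s \<noteq> \<zero>}" by auto
  with cf show "c \<odot>\<^bsub>free_module R S\<^esub> f \<in> carrier (free_module R S)"
    by (auto simp: free_module_simps intro: finite_subset)
qed (auto simp: free_module_simps l_distr r_distr m_assoc cring_axioms)

lemma free_gen_closed: "s \<in> S \<Longrightarrow> free_gen R s \<in> carrier (free_module R S)"
  by (auto simp: free_module_simps free_gen_def)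

end

text \<open>The lift is the linear combination taken over the support. Supports change under
  addition and scaling, so linearity is checked after extending the sums to a common finite
  set.\<close>

lemma (in module) free_module_lift:
  assumes \<beta>: "\<And>s. s \<in> S \<Longrightarrow> \<beta> s \<in> carrier M"
  shows "\<exists>f\<in>lin_hom R (free_module R S) M. \<forall>s\<in>S. f (free_gen R s) = \<beta> s"
proof -
  define f where "f a = (\<Oplus>\<^bsub>M\<^esub>s\<in>{s. a s \<noteq> \<zero>}. a s \<odot>\<^bsub>M\<^esub> \<beta> s)" for a
  have scaled: "a s \<odot>\<^bsub>M\<^esub> \<beta> s \<in> carrier M" if "a \<in> carrier (free_module R S)" "s \<in> S" for a s
    using that \<beta> by (simp add: free_module_simps)
  \<comment> \<open>Any finite set between the support and \<open>S\<close> may replace the support: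
    the extra terms have coefficient zero. The bound \<open>S\<close> stays because
    \<open>\<beta>\<close> is known to take values in \<open>M\<close> only there.\<close>
  have f_eq: "f a = (\<Oplus>\<^bsub>M\<^esub>s\<in>T. a s \<odot>\<^bsub>M\<^esub> \<beta> s)"
    if "a \<in> carrier (free_module R S)" "finite T" "T \<subseteq> S" "{s. a s \<noteq> \<zero>} \<subseteq> T" for a T
    unfolding f_def using that \<beta>
    by (intro M.add.finprod_mono_neutral_cong_left) (auto simp: free_module_simps subset_iff)
  have support: "finite {s. a s \<noteq> \<zero>}" "{s. a s \<noteq> \<zero>} \<subseteq> S"
    if "a \<in> carrier (free_module R S)" for a
    using that by (auto simp: free_module_simps)
  interpret F: module R "free_module R S" by (rule module_free_module)
  have "f \<in> lin_hom R (free_module R S) M"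
    unfolding lin_hom_def
  proof (intro CollectI conjI ballI Pi_I)
    fix a assume a: "a \<in> carrier (free_module R S)"
    then show "f a \<in> carrier M"
      unfolding f_def using support scaled by (blast intro: M.finsum_closed)
    fix b assume b: "b \<in> carrier (free_module R S)"
    let ?T = "{s. a s \<noteq> \<zero>} \<union> {s. b s \<noteq> \<zero>}"
    have T: "finite ?T" "?T \<subseteq> S" using a b support by auto
    have "{s. (a \<oplus>\<^bsub>free_module R S\<^esub> b) s \<noteq> \<zero>} \<subseteq> ?T"
      by (auto simp: free_module_simps)
    then have "f (a \<oplus>\<^bsub>free_module R S\<^esub> b) = (\<Oplus>\<^bsub>M\<^esub>s\<in>?T. (a s \<oplus> b s) \<odot>\<^bsub>M\<^esub> \<beta> s)"
      using f_eq[of "a \<oplus>\<^bsub>free_module R S\<^esub> b" ?T] F.a_closed a b T by (simp add: free_module_simps(2))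
    also have "\<dots> = (\<Oplus>\<^bsub>M\<^esub>s\<in>?T. a s \<odot>\<^bsub>M\<^esub> \<beta> s \<oplus>\<^bsub>M\<^esub> b s \<odot>\<^bsub>M\<^esub> \<beta> s)"
      using a b T \<beta> by (intro M.finsum_cong') (auto simp: free_module_simps intro!: smult_l_distr)
    also have "\<dots> = (\<Oplus>\<^bsub>M\<^esub>s\<in>?T. a s \<odot>\<^bsub>M\<^esub> \<beta> s) \<oplus>\<^bsub>M\<^esub> (\<Oplus>\<^bsub>M\<^esub>s\<in>?T. b s \<odot>\<^bsub>M\<^esub> \<beta> s)"
      using a b T scaled by (intro M.finsum_addf) blast+
    also have "\<dots> = f a \<oplus>\<^bsub>M\<^esub> f b"
      using f_eq[of a ?T] f_eq[of b ?T] a b T by simp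
    finally show "f (a \<oplus>\<^bsub>free_module R S\<^esub> b) = f a \<oplus>\<^bsub>M\<^esub> f b" .
  next
    fix c a assume c: "c \<in> carrier R" and a: "a \<in> carrier (free_module R S)"
    let ?T = "{s. a s \<noteq> \<zero>}"
    have "{s. (c \<odot>\<^bsub>free_module R S\<^esub> a) s \<noteq> \<zero>} \<subseteq> ?T"
      using c by (auto simp: free_module_simps)
    then have "f (c \<odot>\<^bsub>free_module R S\<^esub> a) = (\<Oplus>\<^bsub>M\<^esub>s\<in>?T. (c \<otimes> a s) \<odot>\<^bsub>M\<^esub> \<beta> s)"
      using f_eq[of "c \<odot>\<^bsub>free_module R S\<^esub> a" ?T] F.smult_closed c a support
      by (simp add: free_module_simps(3))
    also have "\<dots> = (\<Oplus>\<^bsub>M\<^esub>s\<in>?T. c \<odot>\<^bsub>M\<^esub> (a s \<odot>\<^bsub>M\<^esub> \<beta> s))"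
      using a c \<beta> support[OF a]
      by (intro M.finsum_cong') (auto simp: free_module_simps intro!: smult_assoc1)
    also have "\<dots> = c \<odot>\<^bsub>M\<^esub> f a"
      unfolding f_def using a c scaled support[OF a] by (intro finsum_smult_ldistr[symmetric]) blast+
    finally show "f (c \<odot>\<^bsub>free_module R S\<^esub> a) = c \<odot>\<^bsub>M\<^esub> f a" .
  qed
  moreover have "f (free_gen R s) = \<beta> s" if "s \<in> S" for s
  proof -
    \<comment> \<open>An inclusion rather than an equality, since the support is empty when
      \<open>\<one> = \<zero>\<close> in the ground ring.\<close>
    have "{t. free_gen R s t \<noteq> \<zero>} \<subseteq> {s}"
      by (auto simp: free_gen_def)
    then have "f (free_gen R s) = (\<Oplus>\<^bsub>M\<^esub>t\<in>{s}. free_gen R s t \<odot>\<^bsub>M\<^esub> \<beta> t)"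
      using that by (intro f_eq free_gen_closed) simp_all
    then show ?thesis
      using \<beta>[OF that] by (simp add: free_gen_def)
  qed
  ultimately show ?thesis by (intro bexI ballI)
qed

section \<open>Bilinear maps and the tensor product\<close>

definition bilinear_map ::
  "('k, 'm) ring_scheme \<Rightarrow> ('k, 'a, 'n) module_scheme \<Rightarrow> ('k, 'b, 'l) module_scheme \<Rightarrow>
    ('k, 'c, 'o) module_scheme \<Rightarrow> ('a \<Rightarrow> 'b \<Rightarrow> 'c) \<Rightarrow> bool"
  where "bilinear_map K M N P \<beta> \<longleftrightarrow>
    (\<forall>x\<in>carrier M. \<beta> x \<in> lin_hom K N P) \<and> (\<forall>y\<in>carrier N. (\<lambda>x. \<beta> x y) \<in> lin_hom K M P)"

context
  fixes K :: "('k, 'm) ring_scheme" and M :: "('k, 'a, 'n) module_scheme"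
    and N :: "('k, 'b, 'l) module_scheme" and P :: "('k, 'c, 'o) module_scheme"
  assumes M: "module K M" and N: "module K N" and P: "module K P"
begin

interpretation M: module K M by (rule M)
interpretation N: module K N by (rule N)
interpretation P: module K P by (rule P)

private abbreviation (input) "F \<equiv> free_module K (carrier M \<times> carrier N)"

interpretation F: module K F by (rule M.module_free_module)

lemma tensor_relations_subset: "tensor_relations K M N \<subseteq> carrier F"
  unfolding tensor_relations_def Let_def
  by (auto intro!: F.minus_closed F.a_closed F.smult_closed M.free_gen_closed)

lemma submodule_tensor_submodule: "submodule (tensor_submodule K M N) K F"
  unfolding tensor_submodule_def by (intro F.submodule_submodule_span tensor_relations_subset)

lemma tensor_relations_le: "tensor_relations K M N \<subseteq> tensor_submodule K M N"
  unfolding tensor_submodule_def by (rule F.submodule_span_superset)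

lemma pure_tensor_closed:
  "x \<in> carrier M \<Longrightarrow> y \<in> carrier N \<Longrightarrow> pure_tensor K M N x y \<in> carrier (tensor_product K M N)"
  using F.a_rcosetsI[OF F.submoduleE(1)[OF submodule_tensor_submodule]]
    M.free_gen_closed[of "(x, y)" "carrier M \<times> carrier N"]
  by (simp add: pure_tensor_def tensor_product_def quotient_module_def)

lemma bilinear_map_pure_tensor: "bilinear_map K M N (tensor_product K M N) (pure_tensor K M N)"
proof -
  let ?H = "tensor_submodule K M N" and ?\<delta> = "free_gen K"
  note H = submodule_tensor_submodule
  have \<delta>: "?\<delta> (x, y) \<in> carrier F" if "x \<in> carrier M" "y \<in> carrier N" for x y
    using that by (simp add: M.free_gen_closed)
  have relI: "?H +>\<^bsub>F\<^esub> a = ?H +>\<^bsub>F\<^esub> b"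
    if "a \<ominus>\<^bsub>F\<^esub> b \<in> tensor_relations K M N" "a \<in> carrier F" "b \<in> carrier F" for a b
    using that tensor_relations_le by (intro F.coset_eqI[OF H]) auto
  \<comment> \<open>Unfolded, the premise is membership in a union of four families, nested to the
    left. In the next four proofs the chain of \<open>UnI1\<close> and \<open>UnI2\<close> selects
    the family that matches the identity.\<close>
  note relI = relI[unfolded tensor_relations_def Let_def]
  have add_left: "?H +>\<^bsub>F\<^esub> ?\<delta> (x \<oplus>\<^bsub>M\<^esub> x', y) = ?H +>\<^bsub>F\<^esub> (?\<delta> (x, y) \<oplus>\<^bsub>F\<^esub> ?\<delta> (x', y))"
    if "x \<in> carrier M" "x' \<in> carrier M" "y \<in> carrier N" for x x' y
    by (rule relI, rule UnI1, rule UnI1, rule UnI1, rule CollectI, intro exI conjI, rule refl)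
      (simp_all add: that \<delta>)
  have add_right: "?H +>\<^bsub>F\<^esub> ?\<delta> (x, y \<oplus>\<^bsub>N\<^esub> y') = ?H +>\<^bsub>F\<^esub> (?\<delta> (x, y) \<oplus>\<^bsub>F\<^esub> ?\<delta> (x, y'))"
    if "x \<in> carrier M" "y \<in> carrier N" "y' \<in> carrier N" for x y y'
    by (rule relI, rule UnI1, rule UnI1, rule UnI2, rule CollectI, intro exI conjI, rule refl)
      (simp_all add: that \<delta>)
  have smult_left: "?H +>\<^bsub>F\<^esub> ?\<delta> (c \<odot>\<^bsub>M\<^esub> x, y) = ?H +>\<^bsub>F\<^esub> (c \<odot>\<^bsub>F\<^esub> ?\<delta> (x, y))"
    if "c \<in> carrier K" "x \<in> carrier M" "y \<in> carrier N" for c x y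
    by (rule relI, rule UnI1, rule UnI2, rule CollectI, intro exI conjI, rule refl)
      (simp_all add: that \<delta>)
  have smult_right: "?H +>\<^bsub>F\<^esub> ?\<delta> (x, c \<odot>\<^bsub>N\<^esub> y) = ?H +>\<^bsub>F\<^esub> (c \<odot>\<^bsub>F\<^esub> ?\<delta> (x, y))"
    if "c \<in> carrier K" "x \<in> carrier M" "y \<in> carrier N" for c x y
    by (rule relI, rule UnI2, rule CollectI, intro exI conjI, rule refl)
      (simp_all add: that \<delta>)
  have "pure_tensor K M N x \<in> lin_hom K N (tensor_product K M N)" if "x \<in> carrier M" for x
    using that
    by (simp add: lin_hom_def pure_tensor_closed)
      (simp add: pure_tensor_def tensor_product_def add_right smult_right \<delta>
        F.quotient_module_add[OF H] F.quotient_module_smult[OF H])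
  moreover have "(\<lambda>x. pure_tensor K M N x y) \<in> lin_hom K M (tensor_product K M N)" if "y \<in> carrier N" for y
    using that
    by (simp add: lin_hom_def pure_tensor_closed)
      (simp add: pure_tensor_def tensor_product_def add_left smult_left \<delta>
        F.quotient_module_add[OF H] F.quotient_module_smult[OF H])
  ultimately show ?thesis
    by (simp add: bilinear_map_def)
qed

text \<open>This is what makes \<open>on_pure K A C\<close> linear in each argument for a given
  \<open>C\<close>.\<close>

lemma bilinear_map_lin_hom_tensor:
  assumes "C \<in> lin_hom K (tensor_product K M N) P"
  shows "bilinear_map K M N P (\<lambda>x y. C (pure_tensor K M N x y))"
proof -
  have comp: "(\<lambda>z. C (f z)) \<in> lin_hom K L P" if f: "f \<in> lin_hom K L (tensor_product K M N)"
    for f and L :: "('k, 'd, 'r) module_scheme"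
    unfolding lin_hom_def by (simp add: lin_homD[OF f] lin_homD[OF assms])
  show ?thesis
    using bilinear_map_pure_tensor comp[of _ M] comp[of _ N] by (simp add: bilinear_map_def)
qed

text \<open>Extend \<open>\<beta>\<close> to the free module. Bilinearity says that the extension
  kills each generating relation; its kernel is a submodule, so it kills their span as well and
  descends to the quotient.\<close>

lemma tensor_product_lift:
  assumes \<beta>: "bilinear_map K M N P \<beta>"
  obtains C where "C \<in> lin_hom K (tensor_product K M N) P"
    and "\<forall>x\<in>carrier M. \<forall>y\<in>carrier N. C (pure_tensor K M N x y) = \<beta> x y"
proof -
  have \<beta>_closed: "\<beta> x y \<in> carrier P" if "x \<in> carrier M" "y \<in> carrier N" for x y
    using \<beta> that by (auto simp: bilinear_map_def lin_hom_def)
  have \<beta>_left: "\<beta> (x \<oplus>\<^bsub>M\<^esub> x') y = \<beta> x y \<oplus>\<^bsub>P\<^esub> \<beta> x' y" "c \<in> carrier K \<Longrightarrow> \<beta> (c \<odot>\<^bsub>M\<^esub> x) y = c \<odot>\<^bsub>P\<^esub> \<beta> x y"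
    if "x \<in> carrier M" "y \<in> carrier N" "x' \<in> carrier M" for x y x' c
    using \<beta> that by (auto simp: bilinear_map_def lin_hom_def)
  have \<beta>_right: "\<beta> x (y \<oplus>\<^bsub>N\<^esub> y') = \<beta> x y \<oplus>\<^bsub>P\<^esub> \<beta> x y'" "c \<in> carrier K \<Longrightarrow> \<beta> x (c \<odot>\<^bsub>N\<^esub> y) = c \<odot>\<^bsub>P\<^esub> \<beta> x y"
    if "x \<in> carrier M" "y \<in> carrier N" "y' \<in> carrier N" for x y y' c
    using \<beta> that by (auto simp: bilinear_map_def lin_hom_def)
  have "\<exists>f\<in>lin_hom K F P. \<forall>p\<in>carrier M \<times> carrier N. f (free_gen K p) = (\<lambda>(x, y). \<beta> x y) p"
    by (rule P.free_module_lift) (auto simp: \<beta>_closed)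
  then obtain f where f: "f \<in> lin_hom K F P"
    and "\<forall>p\<in>carrier M \<times> carrier N. f (free_gen K p) = (\<lambda>(x, y). \<beta> x y) p"
    by (elim bexE)
  then have f_gen: "f (free_gen K (x, y)) = \<beta> x y" if "x \<in> carrier M" "y \<in> carrier N" for x y
    using that by simp
  interpret f: abelian_group_hom F P f
    by (rule lin_hom_abelian_group_hom[OF F.module_axioms P f])
  have \<delta>: "free_gen K (x, y) \<in> carrier F" if "x \<in> carrier M" "y \<in> carrier N" for x y
    using that by (simp add: M.free_gen_closed)
  have f_minus: "f (a \<ominus>\<^bsub>F\<^esub> b) = f a \<ominus>\<^bsub>P\<^esub> f b" if "a \<in> carrier F" "b \<in> carrier F" for a b
    using that by (simp add: a_minus_def)
  have "tensor_relations K M N \<subseteq> {a \<in> carrier F. f a = \<zero>\<^bsub>P\<^esub>}"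
  proof
    fix a assume a: "a \<in> tensor_relations K M N"
    then have "f a = \<zero>\<^bsub>P\<^esub>"
      unfolding tensor_relations_def Let_def
      by (elim UnE CollectE exE conjE)
        (simp_all add: f_minus \<delta> f_gen \<beta>_closed \<beta>_left \<beta>_right lin_homD[OF f] P.r_neg P.minus_eq)
    with a show "a \<in> {a \<in> carrier F. f a = \<zero>\<^bsub>P\<^esub>}"
      using tensor_relations_subset by auto
  qed
  then have "tensor_submodule K M N \<subseteq> {a \<in> carrier F. f a = \<zero>\<^bsub>P\<^esub>}"
    unfolding tensor_submodule_def
    by (intro F.submodule_span_least F.submodule_lin_hom_kernel[OF P f])
  then obtain C where "C \<in> lin_hom K (tensor_product K M N) P"
    and "\<And>a. a \<in> carrier F \<Longrightarrow> C (tensor_submodule K M N +>\<^bsub>F\<^esub> a) = f a"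
    using F.quotient_module_lift[OF submodule_tensor_submodule P f]
    unfolding tensor_product_def by blast
  then show ?thesis
    using that[of C] \<delta> f_gen by (simp add: pure_tensor_def)
qed

end

section \<open>Linear sections of surjections of vector spaces\<close>

context module
begin

text \<open>Any two elements of the union already lie in one member of the chain, where the closure
  conditions can be checked. Nonemptiness provides the zero element.\<close>

lemma submodule_Union_chain:
  assumes "\<C> \<noteq> {}" "subset.chain {W. submodule W R M} \<C>"
  shows "submodule (\<Union>\<C>) R M"
proof -
  have sub: "submodule W R M" if "W \<in> \<C>" for W
    using that assms(2) by (auto simp: subset.chain_def)
  have chain: "V \<subseteq> W \<or> W \<subseteq> V" if "V \<in> \<C>" "W \<in> \<C>" for V W
    using that assms(2) by (auto simp: subset_chain_def)
  show ?thesis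
  proof (rule submoduleI)
    show "\<Union>\<C> \<subseteq> carrier M"
      using submoduleE(1)[OF sub] by blast
    obtain W where "W \<in> \<C>" using assms(1) by blast
    then show "\<zero>\<^bsub>M\<^esub> \<in> \<Union>\<C>"
      using subgroup.one_closed[OF submodule.axioms(1)[OF sub[of W]]] by auto
  next
    fix a b assume "a \<in> \<Union>\<C>" "b \<in> \<Union>\<C>"
    then obtain V W where VW: "V \<in> \<C>" "a \<in> V" "W \<in> \<C>" "b \<in> W"
      by blast
    then have "a \<in> W \<or> b \<in> V"
      using chain[of V W] by blast
    with VW obtain W where "W \<in> \<C>" "a \<in> W" "b \<in> W"
      by blast
    then show "a \<oplus>\<^bsub>M\<^esub> b \<in> \<Union>\<C>"
      using submoduleE(5)[OF sub] by blast
  next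
    fix a assume "a \<in> \<Union>\<C>"
    then obtain W where W: "W \<in> \<C>" "a \<in> W" by blast
    show "\<ominus>\<^bsub>M\<^esub> a \<in> \<Union>\<C>"
      using W submoduleE(3)[OF sub] by blast
    show "c \<odot>\<^bsub>M\<^esub> a \<in> \<Union>\<C>" if "c \<in> carrier R" for c
      using W that submoduleE(4)[OF sub] by blast
  qed
qed

text \<open>The enlargement \<open>W + R b\<close> that is played against maximality in the
  construction of a complement.\<close>

lemma submodule_adjoin:
  assumes W: "submodule W R M" and b: "b \<in> carrier M"
  shows "submodule {w \<oplus>\<^bsub>M\<^esub> c \<odot>\<^bsub>M\<^esub> b | w c. w \<in> W \<and> c \<in> carrier R} R M" (is "submodule ?V R M")
proof -
  note W_carr = subsetD[OF submoduleE(1)[OF W]]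
  have W0: "\<zero>\<^bsub>M\<^esub> \<in> W"
    using subgroup.one_closed[OF submodule.axioms(1)[OF W]] by simp
  have mem: "x \<in> ?V" if "x = w \<oplus>\<^bsub>M\<^esub> c \<odot>\<^bsub>M\<^esub> b" "w \<in> W" "c \<in> carrier R" for x w c
    using that by blast
  have dest: "\<exists>w c. x = w \<oplus>\<^bsub>M\<^esub> c \<odot>\<^bsub>M\<^esub> b \<and> w \<in> W \<and> c \<in> carrier R" if "x \<in> ?V" for x
    using that by blast
  show ?thesis
  proof (rule submoduleI)
    show "?V \<subseteq> carrier M"
      using b W_carr by auto
    show "\<zero>\<^bsub>M\<^esub> \<in> ?V"
      using b W0 by (intro mem[of _ "\<zero>\<^bsub>M\<^esub>" \<zero>]) simp_all
  next
    fix x y assume "x \<in> ?V" "y \<in> ?V"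
    then obtain w c w' c' where
      x: "x = w \<oplus>\<^bsub>M\<^esub> c \<odot>\<^bsub>M\<^esub> b" "w \<in> W" "c \<in> carrier R" and
      y: "y = w' \<oplus>\<^bsub>M\<^esub> c' \<odot>\<^bsub>M\<^esub> b" "w' \<in> W" "c' \<in> carrier R"
      using dest[of x] dest[of y] by blast
    show "x \<oplus>\<^bsub>M\<^esub> y \<in> ?V"
      using x y b W_carr submoduleE(5)[OF W]
      by (intro mem[of _ "w \<oplus>\<^bsub>M\<^esub> w'" "c \<oplus> c'"]) (simp_all add: smult_l_distr M.a_ac)
  next
    fix x assume "x \<in> ?V"
    then obtain w c where x: "x = w \<oplus>\<^bsub>M\<^esub> c \<odot>\<^bsub>M\<^esub> b" "w \<in> W" "c \<in> carrier R"
      using dest[of x] by blast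
    show "\<ominus>\<^bsub>M\<^esub> x \<in> ?V"
      using x b W_carr submoduleE(3)[OF W]
      by (intro mem[of _ "\<ominus>\<^bsub>M\<^esub> w" "\<ominus> c"]) (simp_all add: smult_l_minus M.minus_add)
    show "d \<odot>\<^bsub>M\<^esub> x \<in> ?V" if "d \<in> carrier R" for d
      using x b W_carr submoduleE(4)[OF W] that
      by (intro mem[of _ "d \<odot>\<^bsub>M\<^esub> w" "d \<otimes> c"]) (simp_all add: smult_r_distr smult_assoc1)
  qed
qed

text \<open>Take \<open>W\<close> maximal among the submodules that meet \<open>U\<close> only in
  zero. If some \<open>b\<close> were outside \<open>U + W\<close>, then adjoining \<open>b\<close>
  to \<open>W\<close> would still give a submodule meeting \<open>U\<close> only in zero, against
  maximality.\<close>

lemma complement_exists: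
  assumes "field R" and U: "submodule U R M"
  obtains W where "submodule W R M" "U \<inter> W = {\<zero>\<^bsub>M\<^esub>}"
    "\<forall>x\<in>carrier M. \<exists>u\<in>U. \<exists>w\<in>W. x = u \<oplus>\<^bsub>M\<^esub> w"
proof -
  interpret field R by fact
  let ?\<A> = "{W. submodule W R M \<and> U \<inter> W = {\<zero>\<^bsub>M\<^esub>}}"
  note U_carr = subsetD[OF submoduleE(1)[OF U]]
  have zero_mem: "\<zero>\<^bsub>M\<^esub> \<in> V" if "submodule V R M" for V
    using subgroup.one_closed[OF submodule.axioms(1)[OF that]] by simp
  have "submodule {\<zero>\<^bsub>M\<^esub>} R M"
    by (rule submoduleI) auto
  then have ne: "?\<A> \<noteq> {}"
    using zero_mem[OF U] by blast
  have "\<exists>W\<in>?\<A>. \<forall>V\<in>?\<A>. W \<subseteq> V \<longrightarrow> V = W"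
  proof (rule subset_Zorn_nonempty[OF ne])
    fix \<C> assume \<C>: "\<C> \<noteq> {}" "subset.chain ?\<A> \<C>"
    have "\<C> \<subseteq> ?\<A>" "subset.chain {W. submodule W R M} \<C>"
      using \<C>(2) by (auto simp: subset_chain_def)
    moreover from this \<C> have "U \<inter> \<Union>\<C> = {\<zero>\<^bsub>M\<^esub>}" by blast
    ultimately show "\<Union>\<C> \<in> ?\<A>"
      using submodule_Union_chain[OF \<C>(1)] by simp
  qed
  then obtain W where W: "submodule W R M" and UW: "U \<inter> W = {\<zero>\<^bsub>M\<^esub>}"
    and max: "\<And>V. submodule V R M \<Longrightarrow> U \<inter> V = {\<zero>\<^bsub>M\<^esub>} \<Longrightarrow> W \<subseteq> V \<Longrightarrow> V = W"
    by auto
  note W_carr = subsetD[OF submoduleE(1)[OF W]]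
  have "\<exists>u\<in>U. \<exists>w\<in>W. b = u \<oplus>\<^bsub>M\<^esub> w" if b: "b \<in> carrier M" for b
  proof (rule ccontr)
    assume not_sum: "\<not> ?thesis"
    define V where "V = {w \<oplus>\<^bsub>M\<^esub> c \<odot>\<^bsub>M\<^esub> b | w c. w \<in> W \<and> c \<in> carrier R}"
    have V: "submodule V R M"
      unfolding V_def using W b by (rule submodule_adjoin)
    have "W \<subseteq> V"
    proof
      fix w assume w: "w \<in> W"
      with b W_carr show "w \<in> V"
        unfolding V_def by (intro CollectI exI[of _ w] exI[of _ \<zero>]) simp
    qed
    moreover have "v = \<zero>\<^bsub>M\<^esub>" if "v \<in> U" "v \<in> V" for v
    proof -
      obtain w c where w: "w \<in> W" and c: "c \<in> carrier R" and v: "v = w \<oplus>\<^bsub>M\<^esub> c \<odot>\<^bsub>M\<^esub> b"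
        using \<open>v \<in> V\<close> unfolding V_def by blast
      \<comment> \<open>With an invertible \<open>c\<close>, the equation \<open>v = w + c b\<close>
        could be solved for \<open>b\<close>, which would place \<open>b\<close> in
        \<open>U + W\<close>.\<close>
      have "c = \<zero>"
      proof (rule ccontr)
        assume "c \<noteq> \<zero>"
        then have inv: "inv c \<in> carrier R" "inv c \<otimes> c = \<one>"
          using c field_Units by auto
        have "c \<odot>\<^bsub>M\<^esub> b = v \<oplus>\<^bsub>M\<^esub> \<ominus>\<^bsub>M\<^esub> w"
          using W_carr[OF w] b c by (simp add: v M.a_ac M.r_neg2)
        then have "inv c \<odot>\<^bsub>M\<^esub> (c \<odot>\<^bsub>M\<^esub> b) = inv c \<odot>\<^bsub>M\<^esub> v \<oplus>\<^bsub>M\<^esub> inv c \<odot>\<^bsub>M\<^esub> (\<ominus>\<^bsub>M\<^esub> w)"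
          using inv U_carr[OF that(1)] W_carr[OF w] by (simp add: smult_r_distr)
        moreover have "inv c \<odot>\<^bsub>M\<^esub> (c \<odot>\<^bsub>M\<^esub> b) = b"
          using inv b c by (simp flip: smult_assoc1)
        ultimately have "b = inv c \<odot>\<^bsub>M\<^esub> v \<oplus>\<^bsub>M\<^esub> inv c \<odot>\<^bsub>M\<^esub> (\<ominus>\<^bsub>M\<^esub> w)"
          by simp
        then have "\<exists>u\<in>U. \<exists>w\<in>W. b = u \<oplus>\<^bsub>M\<^esub> w"
          using submoduleE(4)[OF U inv(1) that(1)] submoduleE(4)[OF W inv(1) submoduleE(3)[OF W w]]
          by (intro bexI)
        with not_sum show False by (rule notE)
      qed
      then have "v = w" using v b W_carr[OF w] by simp
      with w that(1) UW show ?thesis by blast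
    qed
    then have "U \<inter> V = {\<zero>\<^bsub>M\<^esub>}"
      using zero_mem[OF U] zero_mem[OF V] by blast
    ultimately have "V = W"
      using max V by blast
    \<comment> \<open>Maximality thus puts \<open>b\<close> into \<open>W\<close>, and
      \<open>b = 0 + b\<close> is a decomposition of the kind that was excluded.\<close>
    moreover have "b \<in> V"
      using b zero_mem[OF W] unfolding V_def
      by (intro CollectI exI[of _ "\<zero>\<^bsub>M\<^esub>"] exI[of _ \<one>]) simp
    ultimately have "\<exists>u\<in>U. \<exists>w\<in>W. b = u \<oplus>\<^bsub>M\<^esub> w"
      using b zero_mem[OF U] by (intro bexI[of _ "\<zero>\<^bsub>M\<^esub>"] bexI[of _ b]) simp_all
    with not_sum show False by (rule notE)
  qed
  with W UW show ?thesis by (intro that ballI)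
qed

text \<open>An arbitrary choice of preimages would not be linear. On a complement \<open>W\<close>
  of the kernel, however, \<open>p\<close> is bijective onto \<open>N\<close>, and the section is
  the inverse of this restriction.\<close>

lemma linear_section_exists:
  assumes "field R" "module R N" and p: "p \<in> lin_hom R M N" and surj: "p ` carrier M = carrier N"
  obtains s where "s \<in> lin_hom R N M" "\<forall>y\<in>carrier N. p (s y) = y"
proof -
  interpret N: module R N by fact
  interpret p: abelian_group_hom M N p
    using lin_hom_abelian_group_hom[OF module_axioms assms(2) p] .
  let ?U = "{x \<in> carrier M. p x = \<zero>\<^bsub>N\<^esub>}"
  obtain W where W: "submodule W R M" and UW: "?U \<inter> W = {\<zero>\<^bsub>M\<^esub>}"
    and sum: "\<forall>x\<in>carrier M. \<exists>u\<in>?U. \<exists>w\<in>W. x = u \<oplus>\<^bsub>M\<^esub> w"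
    using complement_exists[OF assms(1) submodule_lin_hom_kernel[OF assms(2) p]] .
  note W_carr = subsetD[OF submoduleE(1)[OF W]]
  have ex: "\<exists>w\<in>W. p w = y" if "y \<in> carrier N" for y
  proof -
    have "y \<in> p ` carrier M"
      unfolding surj by (rule that)
    then obtain x where x: "y = p x" "x \<in> carrier M"
      by (rule imageE)
    obtain u w where uw: "u \<in> ?U" "w \<in> W" "x = u \<oplus>\<^bsub>M\<^esub> w"
      using bspec[OF sum x(2)] by (elim bexE)
    have "p w = y"
      unfolding x(1) uw(3) using uw(1) W_carr[OF uw(2)] by simp
    with uw(2) show ?thesis by (rule bexI[rotated])
  qed
  define s where "s y = (SOME w. w \<in> W \<and> p w = y)" for y
  have "s y \<in> W \<and> p (s y) = y" if "y \<in> carrier N" for y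
    unfolding s_def using ex[OF that, unfolded Bex_def] by (rule someI_ex)
  then have s: "s y \<in> W" "p (s y) = y" if "y \<in> carrier N" for y
    using that by simp_all
  \<comment> \<open>Two preimages of \<open>y\<close> in \<open>W\<close> differ by an element of
    the kernel that also lies in \<open>W\<close>, hence by zero. By this uniqueness, linearity of
    \<open>s\<close> only requires that the expected value is in \<open>W\<close> and has the right
    image.\<close>
  have s_eq: "s y = w" if "w \<in> W" "p w = y" for w y
  proof -
    note w = W_carr[OF \<open>w \<in> W\<close>]
    have y: "y \<in> carrier N"
      using p.hom_closed[OF w] that(2) by simp
    note sy = W_carr[OF s(1)[OF y]]
    have "s y \<ominus>\<^bsub>M\<^esub> w \<in> W"
      unfolding a_minus_def by (intro submoduleE[OF W] s y \<open>w \<in> W\<close>)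
    moreover have "p (s y \<ominus>\<^bsub>M\<^esub> w) = \<zero>\<^bsub>N\<^esub>"
      using w sy y by (simp add: a_minus_def s(2) that(2) N.r_neg)
    ultimately have "s y \<ominus>\<^bsub>M\<^esub> w \<in> ?U \<inter> W"
      using M.minus_closed[OF sy w] by simp
    then have "s y \<oplus>\<^bsub>M\<^esub> \<ominus>\<^bsub>M\<^esub> w = \<zero>\<^bsub>M\<^esub>"
      unfolding UW by (simp add: a_minus_def)
    then show ?thesis
      using M.minus_equality[of "s y" "\<ominus>\<^bsub>M\<^esub> w"] sy w by simp
  qed
  have "s \<in> lin_hom R N M"
    unfolding lin_hom_def
  proof (intro CollectI conjI ballI Pi_I)
    fix y assume y: "y \<in> carrier N"
    note sy = W_carr[OF s(1)[OF y]]
    show "s y \<in> carrier M" by (rule sy)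
    show "s (c \<odot>\<^bsub>N\<^esub> y) = c \<odot>\<^bsub>M\<^esub> s y" if "c \<in> carrier R" for c
    proof (rule s_eq)
      show "c \<odot>\<^bsub>M\<^esub> s y \<in> W" by (intro submoduleE(4)[OF W] that s y)
      show "p (c \<odot>\<^bsub>M\<^esub> s y) = c \<odot>\<^bsub>N\<^esub> y" by (simp add: lin_homD(3)[OF p] that sy s(2) y)
    qed
    fix z assume z: "z \<in> carrier N"
    note sz = W_carr[OF s(1)[OF z]]
    show "s (y \<oplus>\<^bsub>N\<^esub> z) = s y \<oplus>\<^bsub>M\<^esub> s z"
    proof (rule s_eq)
      show "s y \<oplus>\<^bsub>M\<^esub> s z \<in> W" by (intro submoduleE(5)[OF W] s y z)
      show "p (s y \<oplus>\<^bsub>M\<^esub> s z) = y \<oplus>\<^bsub>N\<^esub> z" by (simp add: sy sz s(2) y z)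
    qed
  qed
  from this s(2) show ?thesis by (intro that ballI)
qed

end

section \<open>Square zero extensions from cocycles\<close>

context central_bimodule
begin

section \<open>Arithmetic of the two actions\<close>

lemma lact_hom: "x \<in> carrier A \<Longrightarrow> abelian_group_hom I I (lact I x)"
  by (intro abelian_group_homI I.abelian_group_axioms group_hom.intro I.a_group
      group_hom_axioms.intro homI) (simp_all add: lact_closed lact_add_right)

lemma ract_hom: "x \<in> carrier A \<Longrightarrow> abelian_group_hom I I (\<lambda>u. ract I u x)"
  by (intro abelian_group_homI I.abelian_group_axioms group_hom.intro I.a_group
      group_hom_axioms.intro homI) (simp_all add: ract_closed ract_add_left)

lemma lact_hom_left: "u \<in> carrier I \<Longrightarrow> abelian_group_hom A I (\<lambda>x. lact I x u)"
  by (intro abelian_group_homI I.abelian_group_axioms A.abelian_group_axioms group_hom.intro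
      I.a_group A.a_group group_hom_axioms.intro homI) (simp_all add: lact_closed lact_add_left)

lemma ract_hom_right: "u \<in> carrier I \<Longrightarrow> abelian_group_hom A I (ract I u)"
  by (intro abelian_group_homI I.abelian_group_axioms A.abelian_group_axioms group_hom.intro
      I.a_group A.a_group group_hom_axioms.intro homI) (simp_all add: ract_closed ract_add_right)

lemma act_zero:
  "x \<in> carrier A \<Longrightarrow> lact I x \<zero>\<^bsub>I\<^esub> = \<zero>\<^bsub>I\<^esub>"
  "x \<in> carrier A \<Longrightarrow> ract I \<zero>\<^bsub>I\<^esub> x = \<zero>\<^bsub>I\<^esub>"
  "u \<in> carrier I \<Longrightarrow> lact I \<zero>\<^bsub>A\<^esub> u = \<zero>\<^bsub>I\<^esub>"
  "u \<in> carrier I \<Longrightarrow> ract I u \<zero>\<^bsub>A\<^esub> = \<zero>\<^bsub>I\<^esub>"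
  by (fact abelian_group_hom.hom_zero[OF lact_hom] abelian_group_hom.hom_zero[OF ract_hom]
    abelian_group_hom.hom_zero[OF lact_hom_left] abelian_group_hom.hom_zero[OF ract_hom_right])+

lemma act_minus:
  "x \<in> carrier A \<Longrightarrow> u \<in> carrier I \<Longrightarrow> lact I x (\<ominus>\<^bsub>I\<^esub> u) = \<ominus>\<^bsub>I\<^esub> lact I x u"
  "x \<in> carrier A \<Longrightarrow> u \<in> carrier I \<Longrightarrow> ract I (\<ominus>\<^bsub>I\<^esub> u) x = \<ominus>\<^bsub>I\<^esub> ract I u x"
  by (fact abelian_group_hom.hom_a_inv[OF lact_hom] abelian_group_hom.hom_a_inv[OF ract_hom])+

lemma smult_one_commutes:
  assumes "c \<in> carrier K" "x \<in> carrier A"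
  shows "(c \<odot>\<^bsub>A\<^esub> \<one>\<^bsub>A\<^esub>) \<otimes>\<^bsub>A\<^esub> x = c \<odot>\<^bsub>A\<^esub> x" "x \<otimes>\<^bsub>A\<^esub> (c \<odot>\<^bsub>A\<^esub> \<one>\<^bsub>A\<^esub>) = c \<odot>\<^bsub>A\<^esub> x"
  using assms by (simp_all add: A.smult_mult_left A.smult_mult_right)

text \<open>The axioms link scalars to the actions only through the elements \<open>c 1\<close> of
  \<open>A\<close>. Writing \<open>c x\<close> as \<open>(c 1) x\<close> or as
  \<open>x (c 1)\<close> and splitting the action along the product moves the scalar to either
  side.\<close>

lemma act_smult:
  assumes c: "c \<in> carrier K" and x: "x \<in> carrier A" and u: "u \<in> carrier I"
  shows "lact I (c \<odot>\<^bsub>A\<^esub> x) u = c \<odot>\<^bsub>I\<^esub> lact I x u" "lact I x (c \<odot>\<^bsub>I\<^esub> u) = c \<odot>\<^bsub>I\<^esub> lact I x u"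
    "ract I u (c \<odot>\<^bsub>A\<^esub> x) = c \<odot>\<^bsub>I\<^esub> ract I u x" "ract I (c \<odot>\<^bsub>I\<^esub> u) x = c \<odot>\<^bsub>I\<^esub> ract I u x"
proof -
  let ?c = "c \<odot>\<^bsub>A\<^esub> \<one>\<^bsub>A\<^esub>"
  have c': "?c \<in> carrier A" using c by simp
  have "lact I (?c \<otimes>\<^bsub>A\<^esub> x) u = c \<odot>\<^bsub>I\<^esub> lact I x u"
    using c x u c' by (simp only: lact_mult lact_central lact_closed)
  then show *: "lact I (c \<odot>\<^bsub>A\<^esub> x) u = c \<odot>\<^bsub>I\<^esub> lact I x u"
    by (simp only: smult_one_commutes[OF c x])
  have "lact I (x \<otimes>\<^bsub>A\<^esub> ?c) u = lact I x (c \<odot>\<^bsub>I\<^esub> u)"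
    using c x u c' by (simp only: lact_mult lact_central)
  then show "lact I x (c \<odot>\<^bsub>I\<^esub> u) = c \<odot>\<^bsub>I\<^esub> lact I x u"
    by (simp only: smult_one_commutes[OF c x] *)
  have "ract I u (x \<otimes>\<^bsub>A\<^esub> ?c) = c \<odot>\<^bsub>I\<^esub> ract I u x"
    using c x u c' by (simp only: ract_mult ract_central ract_closed)
  then show **: "ract I u (c \<odot>\<^bsub>A\<^esub> x) = c \<odot>\<^bsub>I\<^esub> ract I u x"
    by (simp only: smult_one_commutes[OF c x])
  have "ract I u (?c \<otimes>\<^bsub>A\<^esub> x) = ract I (c \<odot>\<^bsub>I\<^esub> u) x"
    using c x u c' by (simp only: ract_mult ract_central)
  then show "ract I (c \<odot>\<^bsub>I\<^esub> u) x = c \<odot>\<^bsub>I\<^esub> ract I u x"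
    by (simp only: smult_one_commutes[OF c x] **)
qed

text \<open>Without subtraction, the two sides are the \<open>C\<close>-terms contributed by the two
  bracketings of a triple product. One direction serves associativity of the twisted product, the
  other recognises the defect of a section as a cocycle.\<close>

lemma cocycle_iff:
  assumes closed: "\<And>x y. x \<in> carrier A \<Longrightarrow> y \<in> carrier A \<Longrightarrow> on_pure K A C x y \<in> carrier I"
  shows "cocycle K A I C \<longleftrightarrow>
    (\<forall>x\<in>carrier A. \<forall>y\<in>carrier A. \<forall>z\<in>carrier A.
      lact I x (on_pure K A C y z) \<oplus>\<^bsub>I\<^esub> on_pure K A C x (y \<otimes>\<^bsub>A\<^esub> z)
      = on_pure K A C (x \<otimes>\<^bsub>A\<^esub> y) z \<oplus>\<^bsub>I\<^esub> ract I (on_pure K A C x y) z)"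
proof -
  have "a \<ominus>\<^bsub>I\<^esub> b \<oplus>\<^bsub>I\<^esub> c \<ominus>\<^bsub>I\<^esub> d = \<zero>\<^bsub>I\<^esub> \<longleftrightarrow> a \<oplus>\<^bsub>I\<^esub> c = b \<oplus>\<^bsub>I\<^esub> d"
    if abcd: "a \<in> carrier I" "b \<in> carrier I" "c \<in> carrier I" "d \<in> carrier I" for a b c d
  proof -
    have eq: "a \<ominus>\<^bsub>I\<^esub> b \<oplus>\<^bsub>I\<^esub> c \<ominus>\<^bsub>I\<^esub> d = (a \<oplus>\<^bsub>I\<^esub> c) \<oplus>\<^bsub>I\<^esub> \<ominus>\<^bsub>I\<^esub> (b \<oplus>\<^bsub>I\<^esub> d)"
      using abcd by (simp add: I.minus_eq I.minus_add I.a_ac)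
    show ?thesis
    proof
      assume "a \<oplus>\<^bsub>I\<^esub> c = b \<oplus>\<^bsub>I\<^esub> d"
      then show "a \<ominus>\<^bsub>I\<^esub> b \<oplus>\<^bsub>I\<^esub> c \<ominus>\<^bsub>I\<^esub> d = \<zero>\<^bsub>I\<^esub>"
        unfolding eq using abcd by (simp add: I.r_neg)
    next
      assume "a \<ominus>\<^bsub>I\<^esub> b \<oplus>\<^bsub>I\<^esub> c \<ominus>\<^bsub>I\<^esub> d = \<zero>\<^bsub>I\<^esub>"
      then have "\<ominus>\<^bsub>I\<^esub> (\<ominus>\<^bsub>I\<^esub> (b \<oplus>\<^bsub>I\<^esub> d)) = a \<oplus>\<^bsub>I\<^esub> c"
        unfolding eq using abcd by (intro I.minus_equality) simp_all
      then show "a \<oplus>\<^bsub>I\<^esub> c = b \<oplus>\<^bsub>I\<^esub> d"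
        using abcd by simp
    qed
  qed
  then show ?thesis
    unfolding cocycle_def by (simp add: closed lact_closed ract_closed)
qed

section \<open>The twisted sum as an algebra\<close>

lemma twisted_sum_simps:
  "carrier (twisted_sum K A I C) = carrier I \<times> carrier A"
  "(u, x) \<otimes>\<^bsub>twisted_sum K A I C\<^esub> (v, y)
    = (ract I u y \<oplus>\<^bsub>I\<^esub> lact I x v \<oplus>\<^bsub>I\<^esub> on_pure K A C x y, x \<otimes>\<^bsub>A\<^esub> y)"
  "\<one>\<^bsub>twisted_sum K A I C\<^esub> = (\<ominus>\<^bsub>I\<^esub> on_pure K A C \<one>\<^bsub>A\<^esub> \<one>\<^bsub>A\<^esub>, \<one>\<^bsub>A\<^esub>)"
  "\<zero>\<^bsub>twisted_sum K A I C\<^esub> = (\<zero>\<^bsub>I\<^esub>, \<zero>\<^bsub>A\<^esub>)"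
  "(u, x) \<oplus>\<^bsub>twisted_sum K A I C\<^esub> (v, y) = (u \<oplus>\<^bsub>I\<^esub> v, x \<oplus>\<^bsub>A\<^esub> y)"
  "c \<odot>\<^bsub>twisted_sum K A I C\<^esub> (u, x) = (c \<odot>\<^bsub>I\<^esub> u, c \<odot>\<^bsub>A\<^esub> x)"
  by (simp_all add: twisted_sum_def)

text \<open>Addition and scalars do not see \<open>C\<close>: as a module this is the plain direct
  sum of \<open>I\<close> and \<open>A\<close>.\<close>

lemma module_twisted_sum: "module K (twisted_sum K A I C)"
proof (rule moduleI)
  show "abelian_group (twisted_sum K A I C)"
  proof (rule abelian_groupI)
    fix a assume "a \<in> carrier (twisted_sum K A I C)"
    then obtain u x where "a = (u, x)" "u \<in> carrier I" "x \<in> carrier A"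
      by (auto simp: twisted_sum_simps)
    then have "(\<ominus>\<^bsub>I\<^esub> u, \<ominus>\<^bsub>A\<^esub> x) \<in> carrier (twisted_sum K A I C)"
      "(\<ominus>\<^bsub>I\<^esub> u, \<ominus>\<^bsub>A\<^esub> x) \<oplus>\<^bsub>twisted_sum K A I C\<^esub> a = \<zero>\<^bsub>twisted_sum K A I C\<^esub>"
      by (simp_all add: twisted_sum_simps I.l_neg A.l_neg)
    then show "\<exists>b\<in>carrier (twisted_sum K A I C). b \<oplus>\<^bsub>twisted_sum K A I C\<^esub> a = \<zero>\<^bsub>twisted_sum K A I C\<^esub>"
      by blast
  qed (auto simp: twisted_sum_simps I.a_ac A.a_ac)
qed (auto simp: twisted_sum_simps A.R.is_cring I.smult_l_distr A.smult_l_distr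
  I.smult_r_distr A.smult_r_distr I.smult_assoc1 A.smult_assoc1)

context
  fixes C
  assumes C: "C \<in> lin_hom K (tensor_product K A A) I"
begin

lemma on_pure_lin_hom:
  "x \<in> carrier A \<Longrightarrow> on_pure K A C x \<in> lin_hom K A I"
  "y \<in> carrier A \<Longrightarrow> (\<lambda>x. on_pure K A C x y) \<in> lin_hom K A I"
  using bilinear_map_lin_hom_tensor[OF A.module_axioms A.module_axioms I.module_axioms C]
  by (simp_all add: bilinear_map_def on_pure_def[abs_def])

lemmas on_pure_simps =
  lin_homD[OF on_pure_lin_hom(1)] lin_homD(2,3)[OF on_pure_lin_hom(2)]

text \<open>Hence products with an element \<open>(u, 0)\<close> of the ideal carry no
  \<open>C\<close>-term.\<close>

lemma on_pure_zero: "x \<in> carrier A \<Longrightarrow> on_pure K A C x \<zero>\<^bsub>A\<^esub> = \<zero>\<^bsub>I\<^esub>" "x \<in> carrier A \<Longrightarrow> on_pure K A C \<zero>\<^bsub>A\<^esub> x = \<zero>\<^bsub>I\<^esub>"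
  by (fact abelian_group_hom.hom_zero[OF lin_hom_abelian_group_hom[OF A.module_axioms I.module_axioms on_pure_lin_hom(1)]]
    abelian_group_hom.hom_zero[OF lin_hom_abelian_group_hom[OF A.module_axioms I.module_axioms on_pure_lin_hom(2)]])+

context
  assumes cocycle: "cocycle K A I C"
begin

lemma on_pure_cocycle:
  assumes "x \<in> carrier A" "y \<in> carrier A" "z \<in> carrier A"
  shows "on_pure K A C (x \<otimes>\<^bsub>A\<^esub> y) z \<oplus>\<^bsub>I\<^esub> ract I (on_pure K A C x y) z
    = lact I x (on_pure K A C y z) \<oplus>\<^bsub>I\<^esub> on_pure K A C x (y \<otimes>\<^bsub>A\<^esub> z)"
  using cocycle_iff[of C] cocycle assms by (simp add: on_pure_simps(1))

text \<open>In the cocycle identity at \<open>(1, 1, x)\<close> and at \<open>(x, 1, 1)\<close> one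
  value of \<open>C\<close> occurs on both sides. Cancelling it leaves these formulas, which say
  what the first component of the unit has to compensate.\<close>

lemma on_pure_one:
  assumes x: "x \<in> carrier A"
  shows "on_pure K A C \<one>\<^bsub>A\<^esub> x = ract I (on_pure K A C \<one>\<^bsub>A\<^esub> \<one>\<^bsub>A\<^esub>) x"
    and "on_pure K A C x \<one>\<^bsub>A\<^esub> = lact I x (on_pure K A C \<one>\<^bsub>A\<^esub> \<one>\<^bsub>A\<^esub>)"
proof -
  have closed: "on_pure K A C y z \<in> carrier I" if "y \<in> carrier A" "z \<in> carrier A" for y z
    using on_pure_simps(1) that by simp
  show "on_pure K A C \<one>\<^bsub>A\<^esub> x = ract I (on_pure K A C \<one>\<^bsub>A\<^esub> \<one>\<^bsub>A\<^esub>) x"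
    using on_pure_cocycle[OF A.one_closed A.one_closed x] x
    by (simp add: closed lact_one ract_closed)
  show "on_pure K A C x \<one>\<^bsub>A\<^esub> = lact I x (on_pure K A C \<one>\<^bsub>A\<^esub> \<one>\<^bsub>A\<^esub>)"
    using on_pure_cocycle[OF x A.one_closed A.one_closed] x
    by (simp add: closed ract_one lact_closed)
qed

lemma monoid_twisted_sum: "monoid (twisted_sum K A I C)"
proof (rule monoidI)
  fix a b c
  assume "a \<in> carrier (twisted_sum K A I C)" "b \<in> carrier (twisted_sum K A I C)"
    "c \<in> carrier (twisted_sum K A I C)"
  then obtain u x v y w z where
    abc: "a = (u, x)" "b = (v, y)" "c = (w, z)" and
    I: "u \<in> carrier I" "v \<in> carrier I" "w \<in> carrier I" and
    A: "x \<in> carrier A" "y \<in> carrier A" "z \<in> carrier A"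
    by (auto simp: twisted_sum_simps)
  let ?\<gamma> = "on_pure K A C"
  \<comment> \<open>The three terms free of \<open>C\<close>, common to both bracketings; what
    remains on each side is one side of the cocycle identity.\<close>
  let ?S = "ract I (ract I u y) z \<oplus>\<^bsub>I\<^esub> lact I x (ract I v z) \<oplus>\<^bsub>I\<^esub> lact I x (lact I y w)"
  note closed = I A on_pure_simps(1) lact_closed ract_closed
  have "ract I (ract I u y \<oplus>\<^bsub>I\<^esub> lact I x v \<oplus>\<^bsub>I\<^esub> ?\<gamma> x y) z \<oplus>\<^bsub>I\<^esub> lact I (x \<otimes>\<^bsub>A\<^esub> y) w \<oplus>\<^bsub>I\<^esub> ?\<gamma> (x \<otimes>\<^bsub>A\<^esub> y) z
      = ?S \<oplus>\<^bsub>I\<^esub> (?\<gamma> (x \<otimes>\<^bsub>A\<^esub> y) z \<oplus>\<^bsub>I\<^esub> ract I (?\<gamma> x y) z)"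
    by (simp add: closed ract_add_left lact_mult lact_ract I.a_ac)
  also have "\<dots> = ?S \<oplus>\<^bsub>I\<^esub> (lact I x (?\<gamma> y z) \<oplus>\<^bsub>I\<^esub> ?\<gamma> x (y \<otimes>\<^bsub>A\<^esub> z))"
    unfolding on_pure_cocycle[OF A] ..
  also have "\<dots> = ract I u (y \<otimes>\<^bsub>A\<^esub> z) \<oplus>\<^bsub>I\<^esub> lact I x (ract I v z \<oplus>\<^bsub>I\<^esub> lact I y w \<oplus>\<^bsub>I\<^esub> ?\<gamma> y z) \<oplus>\<^bsub>I\<^esub> ?\<gamma> x (y \<otimes>\<^bsub>A\<^esub> z)"
    by (simp add: closed lact_add_right ract_mult I.a_ac)
  finally show "a \<otimes>\<^bsub>twisted_sum K A I C\<^esub> b \<otimes>\<^bsub>twisted_sum K A I C\<^esub> c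
      = a \<otimes>\<^bsub>twisted_sum K A I C\<^esub> (b \<otimes>\<^bsub>twisted_sum K A I C\<^esub> c)"
    by (simp add: abc twisted_sum_simps A A.m_assoc)
next
  fix a assume "a \<in> carrier (twisted_sum K A I C)"
  then obtain u x where a: "a = (u, x)" and ux: "u \<in> carrier I" "x \<in> carrier A"
    by (auto simp: twisted_sum_simps)
  let ?e = "on_pure K A C \<one>\<^bsub>A\<^esub> \<one>\<^bsub>A\<^esub>"
  have e: "?e \<in> carrier I" by (simp add: on_pure_simps(1))
  \<comment> \<open>The first component of the product is \<open>- e x + u + C(1, x)\<close> with
    \<open>e = C(1, 1)\<close>, and \<open>C(1, x) = e x\<close>.\<close>
  show "\<one>\<^bsub>twisted_sum K A I C\<^esub> \<otimes>\<^bsub>twisted_sum K A I C\<^esub> a = a"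
    using ux e by (simp add: a twisted_sum_simps on_pure_one(1)[OF ux(2)] lact_one act_minus ract_closed
        I.a_ac I.r_neg1 I.r_neg2 I.l_neg I.r_neg)
  show "a \<otimes>\<^bsub>twisted_sum K A I C\<^esub> \<one>\<^bsub>twisted_sum K A I C\<^esub> = a"
    using ux e by (simp add: a twisted_sum_simps on_pure_one(2)[OF ux(2)] ract_one act_minus lact_closed
        I.a_ac I.r_neg1 I.r_neg2 I.l_neg I.r_neg)
qed (auto simp: twisted_sum_simps on_pure_simps(1) lact_closed ract_closed)

lemma unital_algebra_twisted_sum: "unital_algebra K (twisted_sum K A I C)"
proof -
  interpret T: module K "twisted_sum K A I C" by (rule module_twisted_sum)
  note bilin = on_pure_simps lact_closed ract_closed lact_add_left lact_add_right
    ract_add_left ract_add_right A.l_distr A.r_distr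
  have "ring (twisted_sum K A I C)"
    by (rule ringI[OF T.abelian_group_axioms monoid_twisted_sum])
      (auto simp: twisted_sum_simps bilin I.a_ac)
  moreover have "unital_algebra_axioms K (twisted_sum K A I C)"
    by standard (auto simp: twisted_sum_simps on_pure_simps lact_closed ract_closed act_smult
        I.smult_r_distr A.smult_mult_left A.smult_mult_right)
  ultimately show ?thesis
    by (intro unital_algebra.intro module_twisted_sum)
qed

lemma square_zero_extension_twisted_sum:
  "square_zero_extension K A I (twisted_sum K A I C) (\<lambda>u. (u, \<zero>\<^bsub>A\<^esub>)) snd"
proof -
  let ?T = "twisted_sum K A I C" and ?i = "\<lambda>u. (u, \<zero>\<^bsub>A\<^esub>)"
  interpret T: unital_algebra K ?T by (rule unital_algebra_twisted_sum)
  have i: "?i \<in> lin_hom K I ?T"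
    by (simp add: lin_hom_def twisted_sum_simps)
  have p: "snd \<in> alg_hom K ?T A"
    by (auto simp: alg_hom_def lin_hom_def ring_hom_def twisted_sum_simps)
  have image: "?i ` carrier I = {a \<in> carrier ?T. snd a = \<zero>\<^bsub>A\<^esub>}"
    by (auto simp: twisted_sum_simps)
  have kernel: "?i ` carrier I = a_kernel ?T A snd"
    unfolding image by (simp add: a_kernel_def kernel_def)
  have "submodule (?i ` carrier I) K ?T"
    unfolding image using p by (intro T.submodule_lin_hom_kernel A.module_axioms) (simp add: alg_hom_def)
  then have sub: "subgroup (?i ` carrier I) (add_monoid ?T)"
    by (rule submodule.axioms)
  \<comment> \<open>The first component \<open>a\<close> of the other factor drops out. The ideal
    property, the vanishing of the square and the independence of the induced action from the
    section all rest on this.\<close>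
  have mult_left: "(a, x) \<otimes>\<^bsub>?T\<^esub> (u, \<zero>\<^bsub>A\<^esub>) = (lact I x u, \<zero>\<^bsub>A\<^esub>)"
    and mult_right: "(u, \<zero>\<^bsub>A\<^esub>) \<otimes>\<^bsub>?T\<^esub> (a, x) = (ract I u x, \<zero>\<^bsub>A\<^esub>)"
    if "a \<in> carrier I" "x \<in> carrier A" "u \<in> carrier I" for a x u
    using that by (simp_all add: twisted_sum_simps act_zero on_pure_zero lact_closed ract_closed)
  have ideal: "ideal (?i ` carrier I) ?T"
  proof (rule idealI[OF T.ring_axioms sub])
    fix a b assume "a \<in> ?i ` carrier I" "b \<in> carrier ?T"
    then obtain u v y where "a = (u, \<zero>\<^bsub>A\<^esub>)" "b = (v, y)" "u \<in> carrier I" "v \<in> carrier I" "y \<in> carrier A"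
      by (auto simp: twisted_sum_simps)
    then show "b \<otimes>\<^bsub>?T\<^esub> a \<in> ?i ` carrier I" "a \<otimes>\<^bsub>?T\<^esub> b \<in> ?i ` carrier I"
      by (simp_all add: mult_left mult_right lact_closed ract_closed)
  qed
  have mult_zero: "a \<otimes>\<^bsub>?T\<^esub> b = \<zero>\<^bsub>?T\<^esub>" if "a \<in> ?i ` carrier I" "b \<in> ?i ` carrier I" for a b
    using that by (auto simp: mult_left act_zero twisted_sum_simps(4))
  \<comment> \<open>\<open>ideal_prod\<close> is generated inductively by products and sums, so
    induction reduces the claim to single products.\<close>
  have "a = \<zero>\<^bsub>?T\<^esub>" if "a \<in> ideal_prod ?T (?i ` carrier I) (?i ` carrier I)" for a
    using that by induction (simp_all add: mult_zero)
  moreover have "\<zero>\<^bsub>?T\<^esub> \<in> ideal_prod ?T (?i ` carrier I) (?i ` carrier I)"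
  proof -
    have "\<zero>\<^bsub>?T\<^esub> \<in> ?i ` carrier I" using subgroup.one_closed[OF sub] by simp
    from ideal_prod.prod[OF this this, of ?T] show ?thesis by simp
  qed
  ultimately have square_zero: "ideal_prod ?T (?i ` carrier I) (?i ` carrier I) = {\<zero>\<^bsub>?T\<^esub>}"
    by blast
  have induced: "?i (lact I x u) = s x \<otimes>\<^bsub>?T\<^esub> ?i u \<and> ?i (ract I u x) = ?i u \<otimes>\<^bsub>?T\<^esub> s x"
    if "s \<in> lin_hom K A ?T" "\<And>y. y \<in> carrier A \<Longrightarrow> snd (s y) = y" "x \<in> carrier A" "u \<in> carrier I" for s x u
  proof -
    \<comment> \<open>A section can vary only in its first component, the one that does not affect
      products with the ideal.\<close>
    have "s x = (fst (s x), x)" using that(2)[OF that(3)] by (metis prod.collapse)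
    moreover have "fst (s x) \<in> carrier I"
      using lin_homD(1)[OF that(1,3)] by (auto simp: twisted_sum_simps)
    ultimately show ?thesis
      using mult_left mult_right that(3,4) by metis
  qed
  have surj: "snd ` carrier ?T = carrier A"
    using I.zero_closed by (force simp: twisted_sum_simps)
  show ?thesis
    by (intro square_zero_extension.intro square_zero_extension_axioms.intro central_bimodule_axioms
        T.unital_algebra_axioms i p kernel surj ideal square_zero induced)
      (auto simp: inj_on_def)
qed

end

end

end

section \<open>Cocycles from square zero extensions\<close>

context square_zero_extension
begin

interpretation i: abelian_group_hom I B i
  by (rule lin_hom_abelian_group_hom[OF I.I.module_axioms B.module_axioms i_hom])

lemma p_lin_hom: "p \<in> lin_hom K B A"
  using p_hom unfolding alg_hom_def by (rule IntD2)

lemma p_ring_hom: "p \<in> ring_hom B A"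
  using p_hom unfolding alg_hom_def by (rule IntD1)

interpretation p: abelian_group_hom B A p
  by (rule lin_hom_abelian_group_hom[OF B.module_axioms I.A.module_axioms p_lin_hom])

lemma image_i: "i ` carrier I = {b \<in> carrier B. p b = \<zero>\<^bsub>A\<^esub>}"
  unfolding exact_middle a_kernel_def' ..

lemma p_i: "u \<in> carrier I \<Longrightarrow> p (i u) = \<zero>\<^bsub>A\<^esub>"
  using imageI[of u "carrier I" i] unfolding image_i by simp

lemma i_mult_i:
  assumes "u \<in> carrier I" "v \<in> carrier I"
  shows "i u \<otimes>\<^bsub>B\<^esub> i v = \<zero>\<^bsub>B\<^esub>"
  using ideal_prod.prod[OF imageI[OF assms(1), of i] imageI[OF assms(2), of i], of B]
  unfolding square_zero by simp

section \<open>Decomposition and cocycle given by a linear section\<close>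

context
  fixes s
  assumes s: "s \<in> lin_hom K A B" and p_s: "\<And>y. y \<in> carrier A \<Longrightarrow> p (s y) = y"
begin

interpretation s: abelian_group_hom A B s
  by (rule lin_hom_abelian_group_hom[OF I.A.module_axioms B.module_axioms s])

lemma act_section:
  assumes "x \<in> carrier A" "u \<in> carrier I"
  shows "i (lact I x u) = s x \<otimes>\<^bsub>B\<^esub> i u" "i (ract I u x) = i u \<otimes>\<^bsub>B\<^esub> s x"
proof -
  have "i (lact I x u) = s x \<otimes>\<^bsub>B\<^esub> i u \<and> i (ract I u x) = i u \<otimes>\<^bsub>B\<^esub> s x"
    by (rule induced_action[OF s _ assms]) (rule p_s)
  then show "i (lact I x u) = s x \<otimes>\<^bsub>B\<^esub> i u" "i (ract I u x) = i u \<otimes>\<^bsub>B\<^esub> s x"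
    by (fact conjunct1 conjunct2)+
qed

text \<open>\<open>p\<close> takes the same value on \<open>b\<close> and on \<open>s (p b)\<close>,
  so their difference lies in the image of \<open>i\<close>.\<close>

lemma decompose:
  assumes b: "b \<in> carrier B"
  shows "\<exists>u\<in>carrier I. b = i u \<oplus>\<^bsub>B\<^esub> s (p b)"
proof -
  have "b \<ominus>\<^bsub>B\<^esub> s (p b) \<in> i ` carrier I"
    unfolding image_i using b by (simp add: a_minus_def p_s I.A.r_neg)
  then obtain u where u: "b \<ominus>\<^bsub>B\<^esub> s (p b) = i u" "u \<in> carrier I"
    by (rule imageE)
  have "b = i u \<oplus>\<^bsub>B\<^esub> s (p b)"
    unfolding u(1)[symmetric] using b by (simp add: a_minus_def B.a_assoc B.l_neg)
  with u(2) show ?thesis by (rule bexI[rotated])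
qed

text \<open>Both \<open>s x s y\<close> and \<open>s (x y)\<close> lie over \<open>x y\<close>, so
  their difference can be pulled back along \<open>i\<close>. The equation is stated without
  subtraction so that such equations can be added and scaled directly.\<close>

lemma section_cocycle_exists:
  "\<exists>C\<in>lin_hom K (tensor_product K A A) I.
    \<forall>x\<in>carrier A. \<forall>y\<in>carrier A. i (on_pure K A C x y) \<oplus>\<^bsub>B\<^esub> s (x \<otimes>\<^bsub>A\<^esub> y) = s x \<otimes>\<^bsub>B\<^esub> s y"
proof -
  define \<gamma> where "\<gamma> x y = inv_into (carrier I) i (s x \<otimes>\<^bsub>B\<^esub> s y \<ominus>\<^bsub>B\<^esub> s (x \<otimes>\<^bsub>A\<^esub> y))" for x y
  have \<gamma>: "\<gamma> x y \<in> carrier I" "i (\<gamma> x y) \<oplus>\<^bsub>B\<^esub> s (x \<otimes>\<^bsub>A\<^esub> y) = s x \<otimes>\<^bsub>B\<^esub> s y"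
    if xy: "x \<in> carrier A" "y \<in> carrier A" for x y
  proof -
    have "p (s x \<otimes>\<^bsub>B\<^esub> s y) = x \<otimes>\<^bsub>A\<^esub> y"
      using ring_hom_mult[OF p_ring_hom, of "s x" "s y"] xy by (simp add: p_s)
    then have "s x \<otimes>\<^bsub>B\<^esub> s y \<ominus>\<^bsub>B\<^esub> s (x \<otimes>\<^bsub>A\<^esub> y) \<in> i ` carrier I"
      unfolding image_i using xy by (simp add: a_minus_def p_s I.A.r_neg)
    from inv_into_into[OF this] f_inv_into_f[OF this]
    have *: "\<gamma> x y \<in> carrier I" "i (\<gamma> x y) = s x \<otimes>\<^bsub>B\<^esub> s y \<ominus>\<^bsub>B\<^esub> s (x \<otimes>\<^bsub>A\<^esub> y)"
      unfolding \<gamma>_def by auto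
    show "\<gamma> x y \<in> carrier I" by (rule *)
    show "i (\<gamma> x y) \<oplus>\<^bsub>B\<^esub> s (x \<otimes>\<^bsub>A\<^esub> y) = s x \<otimes>\<^bsub>B\<^esub> s y"
      unfolding *(2) using xy by (simp add: a_minus_def B.a_assoc B.l_neg)
  qed
  \<comment> \<open>Injectivity of \<open>i\<close> makes the equation determine
    \<open>\<gamma> x y\<close>. Each linearity identity below then amounts to checking that its
    right-hand side satisfies the equation.\<close>
  have \<gamma>_eqI: "\<gamma> x y = u"
    if xy: "x \<in> carrier A" "y \<in> carrier A" and u: "u \<in> carrier I"
      and eq: "i u \<oplus>\<^bsub>B\<^esub> s (x \<otimes>\<^bsub>A\<^esub> y) = s x \<otimes>\<^bsub>B\<^esub> s y" for x y u
  proof -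
    have "i (\<gamma> x y) \<oplus>\<^bsub>B\<^esub> s (x \<otimes>\<^bsub>A\<^esub> y) = i u \<oplus>\<^bsub>B\<^esub> s (x \<otimes>\<^bsub>A\<^esub> y)"
      unfolding \<gamma>(2)[OF xy] eq ..
    then have "i (\<gamma> x y) = i u"
      using xy u \<gamma>(1)[OF xy] by simp
    then show ?thesis
      using inj_onD[OF i_inj] \<gamma>(1)[OF xy] u by simp
  qed
  have "\<gamma> x \<in> lin_hom K A I" if x: "x \<in> carrier A" for x
    unfolding lin_hom_def
  proof (intro CollectI conjI ballI Pi_I)
    fix y assume y: "y \<in> carrier A"
    show "\<gamma> x y \<in> carrier I" using x y by (rule \<gamma>)
    show "\<gamma> x (c \<odot>\<^bsub>A\<^esub> y) = c \<odot>\<^bsub>I\<^esub> \<gamma> x y" if c: "c \<in> carrier K" for c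
    proof (rule \<gamma>_eqI)
      have "i (c \<odot>\<^bsub>I\<^esub> \<gamma> x y) \<oplus>\<^bsub>B\<^esub> s (x \<otimes>\<^bsub>A\<^esub> (c \<odot>\<^bsub>A\<^esub> y))
          = c \<odot>\<^bsub>B\<^esub> (i (\<gamma> x y) \<oplus>\<^bsub>B\<^esub> s (x \<otimes>\<^bsub>A\<^esub> y))"
        using x y c \<gamma>(1)
        by (simp add: lin_homD(3)[OF i_hom] lin_homD(3)[OF s] I.A.smult_mult_right B.smult_r_distr)
      also have "\<dots> = s x \<otimes>\<^bsub>B\<^esub> s (c \<odot>\<^bsub>A\<^esub> y)"
        unfolding \<gamma>(2)[OF x y] using x y c by (simp add: lin_homD(3)[OF s] B.smult_mult_right)
      finally show "i (c \<odot>\<^bsub>I\<^esub> \<gamma> x y) \<oplus>\<^bsub>B\<^esub> s (x \<otimes>\<^bsub>A\<^esub> (c \<odot>\<^bsub>A\<^esub> y)) = s x \<otimes>\<^bsub>B\<^esub> s (c \<odot>\<^bsub>A\<^esub> y)" .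
    qed (use x y c \<gamma>(1) in simp_all)
    fix z assume z: "z \<in> carrier A"
    show "\<gamma> x (y \<oplus>\<^bsub>A\<^esub> z) = \<gamma> x y \<oplus>\<^bsub>I\<^esub> \<gamma> x z"
    proof (rule \<gamma>_eqI)
      have "i (\<gamma> x y \<oplus>\<^bsub>I\<^esub> \<gamma> x z) \<oplus>\<^bsub>B\<^esub> s (x \<otimes>\<^bsub>A\<^esub> (y \<oplus>\<^bsub>A\<^esub> z))
          = (i (\<gamma> x y) \<oplus>\<^bsub>B\<^esub> s (x \<otimes>\<^bsub>A\<^esub> y)) \<oplus>\<^bsub>B\<^esub> (i (\<gamma> x z) \<oplus>\<^bsub>B\<^esub> s (x \<otimes>\<^bsub>A\<^esub> z))"
        using x y z \<gamma>(1) by (simp add: I.A.r_distr B.a_ac)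
      also have "\<dots> = s x \<otimes>\<^bsub>B\<^esub> s (y \<oplus>\<^bsub>A\<^esub> z)"
        unfolding \<gamma>(2)[OF x y] \<gamma>(2)[OF x z] using x y z by (simp add: B.r_distr)
      finally show "i (\<gamma> x y \<oplus>\<^bsub>I\<^esub> \<gamma> x z) \<oplus>\<^bsub>B\<^esub> s (x \<otimes>\<^bsub>A\<^esub> (y \<oplus>\<^bsub>A\<^esub> z)) = s x \<otimes>\<^bsub>B\<^esub> s (y \<oplus>\<^bsub>A\<^esub> z)" .
    qed (use x y z \<gamma>(1) in simp_all)
  qed
  moreover have "(\<lambda>x. \<gamma> x y) \<in> lin_hom K A I" if y: "y \<in> carrier A" for y
    unfolding lin_hom_def
  proof (intro CollectI conjI ballI Pi_I)
    fix x assume x: "x \<in> carrier A"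
    show "\<gamma> x y \<in> carrier I" using x y by (rule \<gamma>)
    show "\<gamma> (c \<odot>\<^bsub>A\<^esub> x) y = c \<odot>\<^bsub>I\<^esub> \<gamma> x y" if c: "c \<in> carrier K" for c
    proof (rule \<gamma>_eqI)
      have "i (c \<odot>\<^bsub>I\<^esub> \<gamma> x y) \<oplus>\<^bsub>B\<^esub> s ((c \<odot>\<^bsub>A\<^esub> x) \<otimes>\<^bsub>A\<^esub> y)
          = c \<odot>\<^bsub>B\<^esub> (i (\<gamma> x y) \<oplus>\<^bsub>B\<^esub> s (x \<otimes>\<^bsub>A\<^esub> y))"
        using x y c \<gamma>(1)
        by (simp add: lin_homD(3)[OF i_hom] lin_homD(3)[OF s] I.A.smult_mult_left B.smult_r_distr)
      also have "\<dots> = s (c \<odot>\<^bsub>A\<^esub> x) \<otimes>\<^bsub>B\<^esub> s y"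
        unfolding \<gamma>(2)[OF x y] using x y c by (simp add: lin_homD(3)[OF s] B.smult_mult_left)
      finally show "i (c \<odot>\<^bsub>I\<^esub> \<gamma> x y) \<oplus>\<^bsub>B\<^esub> s ((c \<odot>\<^bsub>A\<^esub> x) \<otimes>\<^bsub>A\<^esub> y) = s (c \<odot>\<^bsub>A\<^esub> x) \<otimes>\<^bsub>B\<^esub> s y" .
    qed (use x y c \<gamma>(1) in simp_all)
    fix z assume z: "z \<in> carrier A"
    show "\<gamma> (x \<oplus>\<^bsub>A\<^esub> z) y = \<gamma> x y \<oplus>\<^bsub>I\<^esub> \<gamma> z y"
    proof (rule \<gamma>_eqI)
      have "i (\<gamma> x y \<oplus>\<^bsub>I\<^esub> \<gamma> z y) \<oplus>\<^bsub>B\<^esub> s ((x \<oplus>\<^bsub>A\<^esub> z) \<otimes>\<^bsub>A\<^esub> y)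
          = (i (\<gamma> x y) \<oplus>\<^bsub>B\<^esub> s (x \<otimes>\<^bsub>A\<^esub> y)) \<oplus>\<^bsub>B\<^esub> (i (\<gamma> z y) \<oplus>\<^bsub>B\<^esub> s (z \<otimes>\<^bsub>A\<^esub> y))"
        using x y z \<gamma>(1) by (simp add: I.A.l_distr B.a_ac)
      also have "\<dots> = s (x \<oplus>\<^bsub>A\<^esub> z) \<otimes>\<^bsub>B\<^esub> s y"
        unfolding \<gamma>(2)[OF x y] \<gamma>(2)[OF z y] using x y z by (simp add: B.l_distr)
      finally show "i (\<gamma> x y \<oplus>\<^bsub>I\<^esub> \<gamma> z y) \<oplus>\<^bsub>B\<^esub> s ((x \<oplus>\<^bsub>A\<^esub> z) \<otimes>\<^bsub>A\<^esub> y) = s (x \<oplus>\<^bsub>A\<^esub> z) \<otimes>\<^bsub>B\<^esub> s y" .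
    qed (use x y z \<gamma>(1) in simp_all)
  qed
  ultimately have "bilinear_map K A A I \<gamma>"
    by (simp add: bilinear_map_def)
  from tensor_product_lift[OF I.A.module_axioms I.A.module_axioms I.I.module_axioms this]
  obtain C where C: "C \<in> lin_hom K (tensor_product K A A) I"
    and C_pure: "\<forall>x\<in>carrier A. \<forall>y\<in>carrier A. C (pure_tensor K A A x y) = \<gamma> x y" .
  show ?thesis
    by (rule bexI[OF _ C]) (simp add: on_pure_def C_pure \<gamma>(2))
qed

context
  fixes C
  assumes C: "C \<in> lin_hom K (tensor_product K A A) I"
    and section_mult: "\<And>x y. x \<in> carrier A \<Longrightarrow> y \<in> carrier A \<Longrightarrow>
      i (on_pure K A C x y) \<oplus>\<^bsub>B\<^esub> s (x \<otimes>\<^bsub>A\<^esub> y) = s x \<otimes>\<^bsub>B\<^esub> s y"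
begin

text \<open>After applying \<open>i\<close> and adding \<open>s (x y z)\<close>, either side of the
  subtraction-free identity becomes the triple product of \<open>s x\<close>, \<open>s y\<close>,
  \<open>s z\<close>. Cancelling \<open>s (x y z)\<close> and using injectivity of \<open>i\<close>
  gives the identity in \<open>I\<close>.\<close>

lemma section_cocycle: "cocycle K A I C"
proof -
  let ?\<gamma> = "on_pure K A C"
  have \<gamma>: "?\<gamma> x y \<in> carrier I" if "x \<in> carrier A" "y \<in> carrier A" for x y
    using I.on_pure_simps(1)[OF C] that by simp
  have "lact I x (?\<gamma> y z) \<oplus>\<^bsub>I\<^esub> ?\<gamma> x (y \<otimes>\<^bsub>A\<^esub> z) = ?\<gamma> (x \<otimes>\<^bsub>A\<^esub> y) z \<oplus>\<^bsub>I\<^esub> ract I (?\<gamma> x y) z"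
    if xyz: "x \<in> carrier A" "y \<in> carrier A" "z \<in> carrier A" for x y z
  proof -
    note closed = xyz \<gamma> I.lact_closed I.ract_closed
    have "i (lact I x (?\<gamma> y z) \<oplus>\<^bsub>I\<^esub> ?\<gamma> x (y \<otimes>\<^bsub>A\<^esub> z)) \<oplus>\<^bsub>B\<^esub> s (x \<otimes>\<^bsub>A\<^esub> (y \<otimes>\<^bsub>A\<^esub> z))
        = s x \<otimes>\<^bsub>B\<^esub> i (?\<gamma> y z) \<oplus>\<^bsub>B\<^esub> (i (?\<gamma> x (y \<otimes>\<^bsub>A\<^esub> z)) \<oplus>\<^bsub>B\<^esub> s (x \<otimes>\<^bsub>A\<^esub> (y \<otimes>\<^bsub>A\<^esub> z)))"
      by (simp add: closed act_section B.a_assoc)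
    \<comment> \<open>The bracketed sum is \<open>s x\<close> times \<open>s (y z)\<close>, so
      \<open>s x\<close> can be factored out.\<close>
    also have "\<dots> = s x \<otimes>\<^bsub>B\<^esub> (i (?\<gamma> y z) \<oplus>\<^bsub>B\<^esub> s (y \<otimes>\<^bsub>A\<^esub> z))"
      unfolding section_mult[OF xyz(1) I.A.m_closed[OF xyz(2,3)]]
      using closed by (intro B.r_distr[symmetric]) simp_all
    also have "\<dots> = (s x \<otimes>\<^bsub>B\<^esub> s y) \<otimes>\<^bsub>B\<^esub> s z"
      by (simp add: closed section_mult B.m_assoc)
    also have "\<dots> = (i (?\<gamma> x y) \<oplus>\<^bsub>B\<^esub> s (x \<otimes>\<^bsub>A\<^esub> y)) \<otimes>\<^bsub>B\<^esub> s z"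
      by (simp add: closed section_mult)
    also have "\<dots> = i (?\<gamma> x y) \<otimes>\<^bsub>B\<^esub> s z \<oplus>\<^bsub>B\<^esub> s (x \<otimes>\<^bsub>A\<^esub> y) \<otimes>\<^bsub>B\<^esub> s z"
      using closed by (intro B.l_distr) simp_all
    also have "\<dots> = i (ract I (?\<gamma> x y) z) \<oplus>\<^bsub>B\<^esub> (i (?\<gamma> (x \<otimes>\<^bsub>A\<^esub> y) z) \<oplus>\<^bsub>B\<^esub> s (x \<otimes>\<^bsub>A\<^esub> y \<otimes>\<^bsub>A\<^esub> z))"
      by (simp add: closed section_mult act_section)
    also have "\<dots> = i (?\<gamma> (x \<otimes>\<^bsub>A\<^esub> y) z \<oplus>\<^bsub>I\<^esub> ract I (?\<gamma> x y) z) \<oplus>\<^bsub>B\<^esub> s (x \<otimes>\<^bsub>A\<^esub> (y \<otimes>\<^bsub>A\<^esub> z))"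
      by (simp add: closed B.a_ac I.A.m_assoc)
    finally have "i (lact I x (?\<gamma> y z) \<oplus>\<^bsub>I\<^esub> ?\<gamma> x (y \<otimes>\<^bsub>A\<^esub> z))
        = i (?\<gamma> (x \<otimes>\<^bsub>A\<^esub> y) z \<oplus>\<^bsub>I\<^esub> ract I (?\<gamma> x y) z)"
      by (subst (asm) B.add.right_cancel) (simp_all add: closed)
    then show ?thesis
      by (rule inj_onD[OF i_inj]) (simp_all add: closed)
  qed
  then show ?thesis
    using I.cocycle_iff[OF \<gamma>] by simp
qed

text \<open>The explicit formula \<open>i u + s x\<close> goes from the twisted sum to
  \<open>B\<close>, whereas \<open>arises_from\<close> asks for a map out of \<open>B\<close>. Hence
  the properties are established for \<open>\<psi>\<close> and carried over to its inverse.\<close>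

lemma section_arises_from: "arises_from K A I B i p C"
proof -
  let ?T = "twisted_sum K A I C" and ?\<gamma> = "on_pure K A C"
  interpret T: unital_algebra K ?T
    by (rule I.unital_algebra_twisted_sum[OF C section_cocycle])
  note T_simps = I.twisted_sum_simps
  have \<gamma>: "?\<gamma> x y \<in> carrier I" if "x \<in> carrier A" "y \<in> carrier A" for x y
    using I.on_pure_simps(1)[OF C] that by simp
  define \<psi> where "\<psi> a = i (fst a) \<oplus>\<^bsub>B\<^esub> s (snd a)" for a
  have T_cases: "\<exists>u x. a = (u, x) \<and> u \<in> carrier I \<and> x \<in> carrier A" if "a \<in> carrier ?T" for a
    using that by (auto simp: T_simps)
  have closed: "\<psi> a \<in> carrier B" if "a \<in> carrier ?T" for a
    using that by (auto simp: T_simps \<psi>_def)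
  have p_\<psi>: "p (\<psi> a) = snd a" if "a \<in> carrier ?T" for a
    using that by (auto simp: T_simps \<psi>_def p_i p_s)
  have mult: "\<psi> (a \<otimes>\<^bsub>?T\<^esub> b) = \<psi> a \<otimes>\<^bsub>B\<^esub> \<psi> b" if a: "a \<in> carrier ?T" and b: "b \<in> carrier ?T" for a b
  proof -
    obtain u x v y where ab: "a = (u, x)" "b = (v, y)" and
      ux: "u \<in> carrier I" "x \<in> carrier A" "v \<in> carrier I" "y \<in> carrier A"
      using T_cases[OF a] T_cases[OF b] by blast
    have "\<psi> a \<otimes>\<^bsub>B\<^esub> \<psi> b = i u \<otimes>\<^bsub>B\<^esub> i v \<oplus>\<^bsub>B\<^esub> i u \<otimes>\<^bsub>B\<^esub> s y \<oplus>\<^bsub>B\<^esub> s x \<otimes>\<^bsub>B\<^esub> i v \<oplus>\<^bsub>B\<^esub> s x \<otimes>\<^bsub>B\<^esub> s y"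
      using ux by (simp add: ab \<psi>_def B.l_distr B.r_distr B.a_ac)
    \<comment> \<open>Square zero removes \<open>i u\<close> times \<open>i v\<close>, the mixed
      terms are the induced actions, and the last term splits by the definition of the
      defect.\<close>
    also have "\<dots> = i (ract I u y) \<oplus>\<^bsub>B\<^esub> i (lact I x v) \<oplus>\<^bsub>B\<^esub> (i (?\<gamma> x y) \<oplus>\<^bsub>B\<^esub> s (x \<otimes>\<^bsub>A\<^esub> y))"
      using ux by (simp add: i_mult_i act_section section_mult)
    also have "\<dots> = \<psi> (a \<otimes>\<^bsub>?T\<^esub> b)"
      using ux by (simp add: ab \<psi>_def T_simps \<gamma> I.lact_closed I.ract_closed B.a_assoc)
    finally show ?thesis by (rule sym)
  qed
  have surj: "\<exists>a\<in>carrier ?T. \<psi> a = b" if b: "b \<in> carrier B" for b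
  proof -
    obtain u where u: "u \<in> carrier I" "b = i u \<oplus>\<^bsub>B\<^esub> s (p b)"
      using decompose[OF b] by (elim bexE)
    show ?thesis
      by (rule bexI[of _ "(u, p b)"]) (use u(1) b in \<open>simp_all add: \<psi>_def T_simps flip: u(2)\<close>)
  qed
  have \<psi>_image: "\<psi> ` carrier ?T = carrier B"
  proof (intro equalityI subsetI)
    fix b assume "b \<in> carrier B"
    then show "b \<in> \<psi> ` carrier ?T" unfolding image_iff using surj[of b] by (simp add: eq_commute)
  next
    fix b assume "b \<in> \<psi> ` carrier ?T"
    then show "b \<in> carrier B" using closed by (elim imageE) simp
  qed
  \<comment> \<open>Applying \<open>p\<close> recovers the second component; the
    \<open>s\<close>-parts then cancel and \<open>i\<close> is injective.\<close>
  have inj: "inj_on \<psi> (carrier ?T)"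
  proof (rule inj_onI)
    fix a b assume a: "a \<in> carrier ?T" and b: "b \<in> carrier ?T" and eq: "\<psi> a = \<psi> b"
    have snd: "snd a = snd b"
      unfolding p_\<psi>[OF a, symmetric] p_\<psi>[OF b, symmetric] eq ..
    have fst: "fst a \<in> carrier I" "fst b \<in> carrier I" "snd b \<in> carrier A"
      using a b by (auto simp: T_simps)
    have "i (fst a) = i (fst b)"
      using eq fst unfolding \<psi>_def snd by simp
    then have "fst a = fst b"
      by (rule inj_onD[OF i_inj]) (rule fst)+
    with snd show "a = b" by (simp add: prod_eq_iff)
  qed
  have "\<psi> \<one>\<^bsub>?T\<^esub> = \<one>\<^bsub>B\<^esub>"
  proof -
    \<comment> \<open>A surjective multiplicative map preserves the unit, so no computation with \<open>C(1, 1)\<close> is needed.\<close>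
    obtain e where e: "e \<in> carrier ?T" "\<psi> e = \<one>\<^bsub>B\<^esub>"
      using surj[OF B.one_closed] by (elim bexE)
    have "\<psi> \<one>\<^bsub>?T\<^esub> = \<psi> \<one>\<^bsub>?T\<^esub> \<otimes>\<^bsub>B\<^esub> \<psi> e"
      unfolding e(2) using closed[OF T.one_closed] by simp
    also have "\<dots> = \<one>\<^bsub>B\<^esub>"
      using mult[OF T.one_closed e(1)] e by simp
    finally show ?thesis .
  qed
  moreover have add: "\<psi> (a \<oplus>\<^bsub>?T\<^esub> b) = \<psi> a \<oplus>\<^bsub>B\<^esub> \<psi> b" if a: "a \<in> carrier ?T" and b: "b \<in> carrier ?T" for a b
    using T_cases[OF a] T_cases[OF b] by (auto simp: \<psi>_def T_simps B.a_ac)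
  ultimately have "\<psi> \<in> ring_iso ?T B"
    using closed mult inj \<psi>_image by (simp add: ring_iso_def ring_hom_def bij_betw_def Pi_iff)
  then have iso: "inv_into (carrier ?T) \<psi> \<in> ring_iso B ?T"
    by (rule ring_iso_set_sym[OF T.ring_axioms])
  let ?\<phi> = "inv_into (carrier ?T) \<psi>"
  have \<phi>: "?\<phi> b \<in> carrier ?T" "\<psi> (?\<phi> b) = b" if "b \<in> carrier B" for b
  proof -
    have "b \<in> \<psi> ` carrier ?T" unfolding \<psi>_image by (rule that)
    then show "?\<phi> b \<in> carrier ?T" "\<psi> (?\<phi> b) = b"
      by (fact inv_into_into f_inv_into_f)+
  qed
  \<comment> \<open>With this, scalar compatibility of the inverse and its value on
    \<open>i u\<close> become computations with \<open>\<psi>\<close>; the latter uses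
    \<open>s 0 = 0\<close>.\<close>
  have \<phi>_eq: "?\<phi> b = a" if "a \<in> carrier ?T" "\<psi> a = b" for a b
    using inv_into_f_f[OF inj that(1)] that(2) by simp
  have smult: "?\<phi> (c \<odot>\<^bsub>B\<^esub> b) = c \<odot>\<^bsub>?T\<^esub> ?\<phi> b" if c: "c \<in> carrier K" and b: "b \<in> carrier B" for c b
  proof (rule \<phi>_eq)
    obtain u x where ux: "?\<phi> b = (u, x)" "u \<in> carrier I" "x \<in> carrier A"
      using T_cases[OF \<phi>(1)[OF b]] by blast
    have "\<psi> (c \<odot>\<^bsub>?T\<^esub> ?\<phi> b) = c \<odot>\<^bsub>B\<^esub> \<psi> (?\<phi> b)"
      using c ux(2,3) unfolding ux(1)
      by (simp add: \<psi>_def T_simps lin_homD(3)[OF i_hom] lin_homD(3)[OF s] B.smult_r_distr)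
    then show "\<psi> (c \<odot>\<^bsub>?T\<^esub> ?\<phi> b) = c \<odot>\<^bsub>B\<^esub> b"
      unfolding \<phi>(2)[OF b] .
  qed (use c b \<phi>(1) in simp)
  have "?\<phi> \<in> ring_hom B ?T"
    using iso by (simp add: ring_iso_def)
  then have "?\<phi> \<in> lin_hom K B ?T"
    using ring_hom_add[of ?\<phi> B ?T] smult \<phi>(1) by (simp add: lin_hom_def)
  with iso have "?\<phi> \<in> alg_iso K B ?T"
    by (simp add: alg_iso_def)
  moreover have "?\<phi> (i u) = (u, \<zero>\<^bsub>A\<^esub>)" if "u \<in> carrier I" for u
    using that by (intro \<phi>_eq) (simp_all add: T_simps \<psi>_def)
  moreover have "snd (?\<phi> b) = p b" if "b \<in> carrier B" for b
    using p_\<psi>[OF \<phi>(1)[OF that]] unfolding \<phi>(2)[OF that] by (rule sym)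
  ultimately show ?thesis
    unfolding arises_from_def by (intro bexI[of _ ?\<phi>]) simp_all
qed

end

end

text \<open>Any linear section will do, because \<open>induced_action\<close> is available for all
  of them. Different sections may give different \<open>C\<close>, and the claim asks for
  one.\<close>

lemma arises_from_cocycle:
  assumes "field K"
  shows "\<exists>C\<in>lin_hom K (tensor_product K A A) I. cocycle K A I C \<and> arises_from K A I B i p C"
proof -
  obtain s where s: "s \<in> lin_hom K A B" and "\<forall>y\<in>carrier A. p (s y) = y"
    using B.linear_section_exists[OF assms I.A.module_axioms p_lin_hom p_surj] .
  then have p_s: "p (s y) = y" if "y \<in> carrier A" for y
    using that by simp
  have "\<exists>C\<in>lin_hom K (tensor_product K A A) I.
    \<forall>x\<in>carrier A. \<forall>y\<in>carrier A. i (on_pure K A C x y) \<oplus>\<^bsub>B\<^esub> s (x \<otimes>\<^bsub>A\<^esub> y) = s x \<otimes>\<^bsub>B\<^esub> s y"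
    by (rule section_cocycle_exists[OF s]) (rule p_s)
  then obtain C where C: "C \<in> lin_hom K (tensor_product K A A) I"
    and "\<forall>x\<in>carrier A. \<forall>y\<in>carrier A. i (on_pure K A C x y) \<oplus>\<^bsub>B\<^esub> s (x \<otimes>\<^bsub>A\<^esub> y) = s x \<otimes>\<^bsub>B\<^esub> s y"
    by (elim bexE)
  then have C_mult: "i (on_pure K A C x y) \<oplus>\<^bsub>B\<^esub> s (x \<otimes>\<^bsub>A\<^esub> y) = s x \<otimes>\<^bsub>B\<^esub> s y"
    if "x \<in> carrier A" "y \<in> carrier A" for x y
    using that by simp
  have "cocycle K A I C"
    by (rule section_cocycle[OF s _ C]) (simp_all add: p_s C_mult)
  moreover have "arises_from K A I B i p C"
    by (rule section_arises_from[OF s _ C]) (simp_all add: p_s C_mult)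
  ultimately show ?thesis using C by (intro bexI conjI)
qed

end

theorem theorem2p8:
  fixes K :: "'k ring" and A :: "('k, 'a) module" and I :: "('k, 'a, 'i) bimodule"
  assumes "field K" and "unital_algebra K A" and "central_bimodule K A I"
  shows "(\<forall>C \<in> lin_hom K (tensor_product K A A) I. cocycle K A I C \<longrightarrow>
            square_zero_extension K A I (twisted_sum K A I C) (\<lambda>u. (u, \<zero>\<^bsub>A\<^esub>)) snd) \<and>
         (\<forall>(B :: ('k, 'b) module) i p. square_zero_extension K A I B i p \<longrightarrow>
            (\<exists>C \<in> lin_hom K (tensor_product K A A) I.
               cocycle K A I C \<and> arises_from K A I B i p C))"
  by (intro conjI ballI allI impI central_bimodule.square_zero_extension_twisted_sum[OF assms(3)]
      square_zero_extension.arises_from_cocycle[OF _ assms(1)])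

end
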